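(* Let $n$ be the input size and $b<n$ the cache-line size, and let $\delta\in(0,1/2)$ satisfy $\delta\ge 1/\operatorname{polylog}(n)$. With high probability in $n$, the Recursive Smoothed Striding Algorithm with parameter $\delta$ achieves work $O(n)$, attains span $O\!\left(b\left(\log^2 n+\frac{\log n}{\delta^2}\right)\right)$, and incurs $(n+O(n\delta))/b$ cache misses.
   Context: Parallel model: algorithms use parallel-for-loops and recursion; work is the running time on one processor, span the running time on infinitely many processors (a parallel-for-loop whose iterations each have span $s$ has span $s+O(1)$). Memory is EREW (no concurrent accesses to a variable). Parallel partition problem: given an array $A[1..n]$ and a decider function classifying each element as a predecessor or successor, rearrange $A$ so all predecessors precede all successors. Cache model: memory is divided into cache lines of $b$ consecutive elements; each processor has a private cache of $\log^{c'} n$ lines ($c'$ a sufficiently large constant); a miss occurs when an accessed line is not in the processor's cache; threads are scheduled by work stealing with no cache-miss cost for stealing, and the cost of initially loading $O(\operatorname{polylog} n)$ global variables into each cache is ignored. Caches are LRU; miss counts are taken with respect to optimal offline (furthest-in-the-future) eviction, which matches LRU up to a $1+1/\operatorname{polylog}(n)$ factor given a $\operatorname{polylog}(n)$-factor larger cache. Partial Partition Step on an array $A$ of length $m$ (parameters $\epsilon,\delta$; $g$ with $gb\mid m$, padding with virtual successors otherwise): let $s=m/(gb)$ with $s>\ln(m/\epsilon)/\delta^2$; choose $X[1..s]$ independently uniform in $\{1,\dots,g\}$; for $i\le g$, $j\le s$ let $G_i(j)=(X[j]+i\bmod g)+(j-1)g+1$ and let $U_i$ be the concatenation of cache lines $G_i(1),\dots,G_i(s)$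 of $A$; in parallel over $i$ serially partition each $U_i$ in place; let $v_i$ be the position in $A$ of the first successor in the partitioned $U_i$ ($m$ if none), $v_{\min}=\min_i v_i$, $v_{\max}=\max_i v_i$ (computed by a divide-and-conquer implementation of the parallel loop). Recursive Smoothed Striding Algorithm with parameter $\delta$: at the top level run the Partial Partition Step with $\epsilon=n^{-c}$ ($c$ a constant of our choice) and the given $\delta$, then recursively apply the same procedure to the subarray $A[v_{\min}+1],\dots,A[v_{\max}]$; at all levels of recursion after the first, the same $\epsilon$ is used but $\delta$ is replaced by a sufficiently small constant $\delta'=\Theta(1)$; when the subproblem is small enough that $g<2$, it is partitioned serially. "With high probability in $n$" means with probability at least $1-n^{-c}$.
   Formalization: The bound of (n+O(nδ))/b cache misses is proved when b divides n or b ≤ δn; otherwise n/b is rounded up, giving ⌈n/b⌉+O(nδ)/b, since the literal bound fails e.g. for n=b+1 and small δ, where two lines must be loaded. *)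

theory Defs
  imports "HOL-Probability.Probability"
begin

section \<open>Cost model\<close>

text \<open>Memory consists of the input array (\<open>Elem i\<close>, 0-based) and of the global array \<open>X\<close>
  (\<open>Glob j\<close>). The \<open>O(1)\<close> local variables of a strand and the values handed over at joins are
  registers. \<open>Local\<close> is any unit-cost operation that does not touch memory.\<close>

datatype addr = Elem nat | Glob nat

datatype op = Local | Access addr

text \<open>A fork-join computation is a list of items executed in series; \<open>Fork l r\<close> runs \<open>l\<close> and \<open>r\<close>
  in parallel and joins them, i.e. it is a parallel loop with two iterations.\<close>

datatype item = Step op | Fork "item list" "item list"

fun comp_work :: "item list \<Rightarrow> nat" where
  "comp_work [] = 0"
| "comp_work (Step a # t) = 1 + comp_work t"
| "comp_work (Fork l r # t) = 1 + comp_work l + comp_work r + comp_work t"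

fun comp_span :: "item list \<Rightarrow> nat" where
  "comp_span [] = 0"
| "comp_span (Step a # t) = 1 + comp_span t"
| "comp_span (Fork l r # t) = 1 + max (comp_span l) (comp_span r) + comp_span t"


section \<open>Cache misses\<close>

text \<open>A schedule lists the strands (maximal fork- and join-free runs) in an order compatible with
  the fork-join dependencies, each with the processor that executes it; any number of processors
  may occur. A work-stealing scheduler migrates work only at forks and joins, so each of its
  executions, on any number of processors, is such a schedule.\<close>

inductive schedule :: "item list \<Rightarrow> (nat \<times> op list) list \<Rightarrow> bool" where
  strand: "schedule (map Step ops) [(p, ops)]"
| fork: "\<lbrakk> schedule l us; schedule r vs; ws \<in> shuffles us vs; schedule t zs \<rbrakk>
    \<Longrightarrow> schedule (map Step ops @ Fork l r # t) ((p, ops) # ws @ zs)"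

text \<open>The cache line of an address for lines of \<open>b\<close> consecutive words; the input array starts at a
  line boundary and shares no line with the globals.\<close>

fun line_of :: "nat \<Rightarrow> addr \<Rightarrow> addr" where
  "line_of b (Elem i) = Elem (i div b)"
| "line_of b (Glob j) = Glob (j div b)"

fun lines :: "nat \<Rightarrow> op list \<Rightarrow> addr list" where
  "lines b [] = []"
| "lines b (Local # ops) = lines b ops"
| "lines b (Access a # ops) = line_of b a # lines b ops"

definition proc_lines :: "nat \<Rightarrow> (nat \<times> op list) list \<Rightarrow> nat \<Rightarrow> addr list" where
  "proc_lines b \<sigma> p = lines b (concat (map snd (filter (\<lambda>z. fst z = p) \<sigma>)))"

text \<open>\<open>cache_run cap S ls k\<close>: starting with cache contents \<open>S\<close>, a cache of \<open>cap\<close> lines can serve the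
  requests \<open>ls\<close> with \<open>k\<close> misses under some (offline) choice of evictions.\<close>

inductive cache_run :: "nat \<Rightarrow> addr set \<Rightarrow> addr list \<Rightarrow> nat \<Rightarrow> bool" for cap where
  finish: "cache_run cap S [] 0"
| access: "\<lbrakk> l \<in> S'; S' \<subseteq> insert l S; finite S'; card S' \<le> cap; cache_run cap S' ls k \<rbrakk>
    \<Longrightarrow> cache_run cap S (l # ls) ((if l \<in> S then 0 else 1) + k)"

text \<open>Misses of one processor under optimal offline eviction. Loading globals into the cache
  initially is free, so the initial contents may be any globals that fit.\<close>

definition opt_misses :: "nat \<Rightarrow> addr list \<Rightarrow> nat" where
  "opt_misses cap ls =
    (LEAST k. \<exists>S. S \<subseteq> range Glob \<and> finite S \<and> card S \<le> cap \<and> cache_run cap S ls k)"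

definition cache_misses :: "nat \<Rightarrow> nat \<Rightarrow> (nat \<times> op list) list \<Rightarrow> nat" where
  "cache_misses b cap \<sigma> = (\<Sum>p\<in>fst ` set \<sigma>. opt_misses cap (proc_lines b \<sigma> p))"


section \<open>Programs\<close>

text \<open>A program maps the contents of the array to a result, the new contents and its computation.\<close>

type_synonym ('e, 'r) prog = "'e list \<Rightarrow> 'r \<times> 'e list \<times> item list"

definition ret :: "'r \<Rightarrow> ('e, 'r) prog" where
  "ret v = (\<lambda>A. (v, A, []))"

definition bind_prog :: "('e, 'r) prog \<Rightarrow> ('r \<Rightarrow> ('e, 'q) prog) \<Rightarrow> ('e, 'q) prog"
  (infixl "\<triangleright>" 55) where
  "p \<triangleright> f = (\<lambda>A. case p A of (v, A', t) \<Rightarrow> (case f v A' of (w, A'', t') \<Rightarrow> (w, A'', t @ t')))"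

definition compute :: "'r \<Rightarrow> ('e, 'r) prog" where
  "compute v = (\<lambda>A. (v, A, [Step Local]))"

definition read_elem :: "nat \<Rightarrow> ('e, 'e) prog" where
  "read_elem i = (\<lambda>A. (A ! i, A, [Step (Access (Elem i))]))"

definition write_elem :: "nat \<Rightarrow> 'e \<Rightarrow> ('e, unit) prog" where
  "write_elem i x = (\<lambda>A. ((), A[i := x], [Step (Access (Elem i))]))"

definition read_X :: "(nat \<Rightarrow> nat) \<Rightarrow> nat \<Rightarrow> ('e, nat) prog" where
  "read_X X j = (\<lambda>A. (X j, A, [Step (Access (Glob j))]))"

text \<open>The two branches of a fork access disjoint parts of the array in all uses below, so that
  running one after the other determines the effect of running them in parallel.\<close>

definition fork :: "('e, 'r) prog \<Rightarrow> ('e, 'q) prog \<Rightarrow> ('e, 'r \<times> 'q) prog" where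
  "fork p q = (\<lambda>A. case p A of (v, A', t) \<Rightarrow> (case q A' of (w, A'', t') \<Rightarrow> ((v, w), A'', [Fork t t'])))"


section \<open>Partial Partition Step\<close>

text \<open>\<open>P\<close> is the decider function: \<open>P x\<close> says that \<open>x\<close> is a predecessor.

  Subarrays are given by an offset \<open>base\<close> and a length \<open>m\<close>; \<open>pos\<close> below computes the offset in the
  subarray of an element of the sequence to be partitioned. The serial partition moves two pointers
  towards each other and returns the number of predecessors.\<close>

function serial_partition ::
  "('e \<Rightarrow> bool) \<Rightarrow> nat \<Rightarrow> (nat \<Rightarrow> ('e, nat) prog) \<Rightarrow> nat \<Rightarrow> nat \<Rightarrow> ('e, nat) prog" where
  "serial_partition P base pos lo hi =
    (if lo < hi then
       pos lo \<triangleright> (\<lambda>p. read_elem (base + p) \<triangleright> (\<lambda>x. compute (P x) \<triangleright> (\<lambda>px.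
         if px then serial_partition P base pos (lo + 1) hi
         else
           pos (hi - 1) \<triangleright> (\<lambda>q. read_elem (base + q) \<triangleright> (\<lambda>y. compute (P y) \<triangleright> (\<lambda>py.
             if py then
               write_elem (base + p) y \<triangleright> (\<lambda>_. write_elem (base + q) x \<triangleright> (\<lambda>_.
                 serial_partition P base pos (lo + 1) (hi - 1)))
             else serial_partition P base pos lo (hi - 1)))))))
     else ret lo)"
  by pat_completeness auto
termination
  by (relation "Wellfounded.measure (\<lambda>(_, _, _, lo, hi). hi - lo)") auto

declare serial_partition.simps [simp del]

text \<open>Parameters of the step on a subarray of length \<open>m\<close>: \<open>num_groups\<close> is \<open>g\<close>, chosen as large as the
  lower bound \<open>min_blocks\<close> on \<open>s\<close> permits, and \<open>num_blocks\<close> is \<open>s\<close>. Virtual successors at the end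
  pad the length to \<open>g * b * s\<close>; this is at most \<open>2 * m\<close>, whence the \<open>2 * m\<close> in \<open>min_blocks\<close>.\<close>

definition min_blocks :: "real \<Rightarrow> real \<Rightarrow> nat \<Rightarrow> nat" where
  "min_blocks \<epsilon> \<delta> m = nat \<lfloor>ln (2 * real m / \<epsilon>) / \<delta>\<^sup>2\<rfloor> + 1"

definition num_groups :: "nat \<Rightarrow> real \<Rightarrow> real \<Rightarrow> nat \<Rightarrow> nat" where
  "num_groups b \<epsilon> \<delta> m = m div (b * min_blocks \<epsilon> \<delta> m)"

definition num_blocks :: "nat \<Rightarrow> real \<Rightarrow> real \<Rightarrow> nat \<Rightarrow> nat" where
  "num_blocks b \<epsilon> \<delta> m = nat \<lceil>real m / real (num_groups b \<epsilon> \<delta> m * b)\<rceil>"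

text \<open>Admissibility of this choice; the padding is shorter than a single group of \<open>g\<close> lines.\<close>

lemma step_params:
  assumes b: "0 < b" and eps: "0 < \<epsilon>" and del: "0 < \<delta>" and g: "1 \<le> num_groups b \<epsilon> \<delta> m"
  shows "m \<le> num_groups b \<epsilon> \<delta> m * b * num_blocks b \<epsilon> \<delta> m"
    and "num_groups b \<epsilon> \<delta> m * b * num_blocks b \<epsilon> \<delta> m < m + num_groups b \<epsilon> \<delta> m * b"
    and "real (num_blocks b \<epsilon> \<delta> m)
           > ln (real (num_groups b \<epsilon> \<delta> m * b * num_blocks b \<epsilon> \<delta> m) / \<epsilon>) / \<delta>\<^sup>2"
proof -
  define s0 where "s0 = min_blocks \<epsilon> \<delta> m"
  define w where "w = num_groups b \<epsilon> \<delta> m * b"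
  define s where "s = num_blocks b \<epsilon> \<delta> m"
  have w: "0 < w" using b g by (simp add: w_def)
  have ws0: "w * s0 \<le> m"
    by (metis w_def s0_def num_groups_def div_times_less_eq_dividend mult.assoc)
  have s0: "1 \<le> s0" by (simp add: s0_def min_blocks_def)
  have wm: "w \<le> m" using mult_le_mono2[OF s0, of w] ws0 by linarith
  have s_eq: "real s = of_int \<lceil>real m / real w\<rceil>"
    by (simp add: s_def num_blocks_def w_def)
  have lo: "real m / real w \<le> real s" and hi: "real s < real m / real w + 1"
    unfolding s_eq by linarith+
  have "real m \<le> real w * real s" using lo w by (simp add: field_simps)
  then show 1: "m \<le> num_groups b \<epsilon> \<delta> m * b * num_blocks b \<epsilon> \<delta> m"
    by (simp add: w_def s_def flip: of_nat_mult)
  have "real w * real s < real m + real w" using hi w by (simp add: field_simps)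
  then have 2: "w * s < m + w" by (simp flip: of_nat_mult of_nat_add)
  then show "num_groups b \<epsilon> \<delta> m * b * num_blocks b \<epsilon> \<delta> m < m + num_groups b \<epsilon> \<delta> m * b"
    by (simp add: w_def s_def)
  have m: "0 < m" using w wm by simp
  have ws: "0 < w * s" using 1 m unfolding w_def s_def by linarith
  have "real (w * s) \<le> 2 * real m" using 2 wm by linarith
  then have "ln (real (w * s) / \<epsilon>) \<le> ln (2 * real m / \<epsilon>)"
    using ws eps m by (subst ln_le_cancel_iff) (auto simp: divide_right_mono)
  then have "ln (real (w * s) / \<epsilon>) / \<delta>\<^sup>2 \<le> ln (2 * real m / \<epsilon>) / \<delta>\<^sup>2"
    by (simp add: divide_right_mono)
  also have "\<dots> < real s0"
    unfolding s0_def min_blocks_def by linarith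
  also have "real s0 \<le> real m / real w"
    using ws0 w by (simp add: field_simps flip: of_nat_mult)
  also have "\<dots> \<le> real s" by (rule lo)
  finally show "real (num_blocks b \<epsilon> \<delta> m)
      > ln (real (num_groups b \<epsilon> \<delta> m * b * num_blocks b \<epsilon> \<delta> m) / \<epsilon>) / \<delta>\<^sup>2"
    by (simp add: w_def s_def)
qed

text \<open>\<open>X j\<close> is \<open>X[j + 1]\<close> in 1-based notation, so block \<open>j\<close> of \<open>U\<^sub>i\<close> is the line with 0-based index
  \<open>G\<^sub>i(j + 1) - 1 = (X j + i) mod g + j * g\<close> of the subarray.\<close>

definition stride_pos :: "nat \<Rightarrow> nat \<Rightarrow> (nat \<Rightarrow> nat) \<Rightarrow> nat \<Rightarrow> nat \<Rightarrow> ('e, nat) prog" where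
  "stride_pos b g X i k =
     read_X X (k div b) \<triangleright> (\<lambda>x. compute (((x + i) mod g + (k div b) * g) * b + k mod b))"

text \<open>Serial partition of \<open>U\<^sub>i\<close>, returning \<open>v\<^sub>i\<close>. Virtual successors occur only in the last group,
  hence at the end of \<open>U\<^sub>i\<close>, and are left alone; \<open>u\<close> is the number of actual elements of \<open>U\<^sub>i\<close>.
  The position \<open>v\<^sub>i\<close> is an offset (the number of elements of the subarray in front of it): with
  this reading the elements at 1-based positions \<open>v\<^sub>m\<^sub>i\<^sub>n + 1, \<dots>, v\<^sub>m\<^sub>a\<^sub>x\<close> are those left to be
  partitioned, and \<open>m\<close> stands for the absence of a successor.\<close>

definition partition_stride ::
  "('e \<Rightarrow> bool) \<Rightarrow> nat \<Rightarrow> nat \<Rightarrow> nat \<Rightarrow> (nat \<Rightarrow> nat) \<Rightarrow> nat \<Rightarrow> nat \<Rightarrow> nat \<Rightarrow> ('e, nat) prog" where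
  "partition_stride P b g s X base m i =
     read_X X (s - 1) \<triangleright> (\<lambda>x.
     compute ((s - 1) * b + min b (m - ((x + i) mod g + (s - 1) * g) * b)) \<triangleright> (\<lambda>u.
     serial_partition P base (stride_pos b g X i) 0 u \<triangleright> (\<lambda>k.
     if k < u then stride_pos b g X i k else ret m)))"

text \<open>Parallel loop over \<open>i \<in> {lo..<hi}\<close> by divide and conquer, returning the minimum and the
  maximum of the results.\<close>

function par_min_max :: "(nat \<Rightarrow> ('e, nat) prog) \<Rightarrow> nat \<Rightarrow> nat \<Rightarrow> ('e, nat \<times> nat) prog" where
  "par_min_max body lo hi =
    (if hi \<le> lo + 1 then body lo \<triangleright> (\<lambda>v. compute (v, v))
     else compute ((lo + hi) div 2) \<triangleright> (\<lambda>_.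
       fork (par_min_max body lo ((lo + hi) div 2)) (par_min_max body ((lo + hi) div 2) hi)
         \<triangleright> (\<lambda>((a, a'), (c, c')). compute (min a c, max a' c'))))"
  by pat_completeness auto
termination
  by (relation "Wellfounded.measure (\<lambda>(_, lo, hi). hi - lo)") auto

declare par_min_max.simps [simp del]

text \<open>The step proper for given \<open>X\<close>, returning \<open>(v\<^sub>m\<^sub>i\<^sub>n, v\<^sub>m\<^sub>a\<^sub>x)\<close>.\<close>

definition partial_partition ::
  "('e \<Rightarrow> bool) \<Rightarrow> nat \<Rightarrow> nat \<Rightarrow> nat \<Rightarrow> (nat \<Rightarrow> nat) \<Rightarrow> nat \<Rightarrow> nat \<Rightarrow> ('e, nat \<times> nat) prog" where
  "partial_partition P b g s X base m =
     par_min_max (partition_stride P b g s X base m) 1 (g + 1)"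

text \<open>The computation that draws \<open>X[1..s]\<close>, and the distribution of its values.\<close>

definition draw_trace :: "nat \<Rightarrow> item list" where
  "draw_trace s = concat (map (\<lambda>j. [Step Local, Step (Access (Glob j))]) [0..<s])"

definition draw_X :: "nat \<Rightarrow> nat \<Rightarrow> (nat \<Rightarrow> nat) pmf" where
  "draw_X g s = Pi_pmf {..<s} 0 (\<lambda>_. pmf_of_set {1..g})"


section \<open>Recursive Smoothed Striding Algorithm\<close>

text \<open>\<open>\<delta>\<close> is the parameter of the current level and \<open>\<delta>'\<close> the one of all deeper levels. The outcome is
  the final array together with the whole computation; the mass missing from the subprobability
  distribution is the probability of nontermination. The leading \<open>Local\<close> stands for the
  computation of \<open>g\<close> and \<open>s\<close>.\<close>

partial_function (spmf) smoothed_striding ::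
  "('e \<Rightarrow> bool) \<Rightarrow> nat \<Rightarrow> real \<Rightarrow> real \<Rightarrow> real \<Rightarrow> nat \<Rightarrow> nat \<Rightarrow> 'e list \<Rightarrow> ('e list \<times> item list) spmf"
  where
  "smoothed_striding P b \<epsilon> \<delta>' \<delta> base m A =
    (if num_groups b \<epsilon> \<delta> m < 2 then
       (case serial_partition P base compute 0 m A of (_, A', t) \<Rightarrow>
          return_spmf (A', Step Local # t))
     else
       bind_spmf (spmf_of_pmf (draw_X (num_groups b \<epsilon> \<delta> m) (num_blocks b \<epsilon> \<delta> m))) (\<lambda>X.
       case partial_partition P b (num_groups b \<epsilon> \<delta> m) (num_blocks b \<epsilon> \<delta> m) X base m A of
         ((vmin, vmax), A', t) \<Rightarrow>
           bind_spmf (smoothed_striding P b \<epsilon> \<delta>' \<delta>' (base + vmin) (vmax - vmin) A') (\<lambda>(A'', t').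
             return_spmf
               (A'', Step Local # draw_trace (num_blocks b \<epsilon> \<delta> m) @ t @ t'))))"

text \<open>The algorithm on a whole array, where \<open>\<epsilon> = n powr (- c)\<close> for its length \<open>n\<close>.\<close>

definition recursive_smoothed_striding ::
  "('e \<Rightarrow> bool) \<Rightarrow> nat \<Rightarrow> real \<Rightarrow> real \<Rightarrow> real \<Rightarrow> 'e list \<Rightarrow> ('e list \<times> item list) spmf" where
  "recursive_smoothed_striding P b c \<delta>' \<delta> A =
     smoothed_striding P b (real (length A) powr (- c)) \<delta>' \<delta> 0 (length A) A"

end

(* With the offsets X drawn independently, the number of predecessors in a stride is a sum of
   independent variables with values in [0, b], one per cache line, whose mean is the same for all
   strides. By Hoeffding's inequality and a union bound, all counts lie within \<delta> s b of that mean
   except with probability \<epsilon>^2, and then v_max - v_min is at most 7 \<delta> m. With \<delta>' \<le> 1/14 the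
   deeper subproblems at least halve, so that their work and cache misses sum to a geometric series
   dominated by the O(\<delta> n) elements left by the top level, which itself loads each line once; the at
   most log n + 2 levels fail with probability at most (log n + 2) n^(-2c) \<le> n^(-c) in total.
   The small probability \<epsilon>^2 per level, instead of \<epsilon>, is what leaves room for the union bound over
   the levels. Cache misses are counted per strand: a cache that pins the lines of X can serve each
   leaf of the parallel loop with one miss per line of its stride, in any schedule. *)
theory Submission
  imports Defs "HOL-Real_Asymp.Real_Asymp"
begin

section \<open>Cache misses of a computation\<close>

text \<open>Every bound on a level is uniform in the contents and the offset of the subarray. The
  recursive call can therefore be treated separately for each outcome of the earlier draws, and no
  conditional distribution arises. Termination has no argument of its own: a lower bound on the mass
  of the good outcomes already excludes the mass lost to nonterminating runs.

  Counts turn into positions as follows. If a stride has K predecessors, its first successor lies in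
  or next to group K div b of the array, hence within O(g b) of K g. So the spread of the v_i is g
  times the spread of the counts plus O(g b), and g b is at most \<open>\<delta>\<^sup>2 * m\<close>
  because the number of blocks is at least \<open>1 / \<delta>\<^sup>2\<close>.

  The leading constant 1 of the miss bound depends on alignment. A subarray starting inside a cache
  line makes each of its blocks straddle two memory lines and doubles the cost. Only the top level,
  with offset 0, is known to be aligned; whatever is paid twice has total size O(\<delta>
  n).\<close>

definition serves :: "nat \<Rightarrow> addr set \<Rightarrow> addr list \<Rightarrow> nat \<Rightarrow> addr set \<Rightarrow> bool" where
  "serves cap S ls k S' \<longleftrightarrow> finite S' \<and> card S' \<le> cap \<and>
    (\<forall>rest r. cache_run cap S' rest r \<longrightarrow> cache_run cap S (ls @ rest) (k + r))"

lemma serves_Nil: "finite S \<Longrightarrow> card S \<le> cap \<Longrightarrow> serves cap S [] 0 S"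
  by (simp add: serves_def)

text \<open>\<open>cache_run\<close> does not expose the contents it ends with.
  \<open>serves\<close> recovers them by quantifying over continuations: any run from
  \<open>S'\<close> can be prefixed by \<open>ls\<close> at the price of \<open>k\<close> misses. In
  this form requests compose without ever splitting a run.\<close>

lemma serves_append:
  assumes "serves cap S ls k S'" "serves cap S' ls' k' S''"
  shows "serves cap S (ls @ ls') (k + k') S''"
proof -
  have "cache_run cap S (ls @ ls' @ rest) (k + (k' + r))" if "cache_run cap S'' rest r" for rest r
    using assms that by (simp add: serves_def)
  then show ?thesis using assms by (simp add: serves_def add.assoc)
qed

lemma serves_Cons:
  assumes "l \<in> T" "T \<subseteq> insert l S" "finite T" "card T \<le> cap" "serves cap T ls k S'"
  shows "serves cap S (l # ls) ((if l \<in> S then 0 else 1) + k) S'"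
proof -
  have "cache_run cap S (l # ls @ rest) ((if l \<in> S then 0 else 1) + (k + r))"
    if "cache_run cap S' rest r" for rest r
    using assms that by (intro cache_run.access[OF assms(1-4)]) (simp add: serves_def)
  then show ?thesis using assms(5) by (simp add: serves_def add.assoc)
qed

text \<open>A request sequence of this cost can be served from any cache that holds the pinned lines
  \<open>GL\<close>, and leaves such a cache behind; this form composes along concatenation.\<close>

definition serve_cost :: "addr set \<Rightarrow> nat \<Rightarrow> addr list \<Rightarrow> nat \<Rightarrow> bool" where
  "serve_cost GL cap ls k \<longleftrightarrow>
    (\<forall>S. finite S \<longrightarrow> GL \<subseteq> S \<longrightarrow> card S \<le> cap \<longrightarrow>
      (\<exists>k' S'. k' \<le> k \<and> GL \<subseteq> S' \<and> serves cap S ls k' S'))"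

lemma serve_costE:
  assumes "serve_cost GL cap ls k" "finite S" "GL \<subseteq> S" "card S \<le> cap"
  obtains k' S' where "k' \<le> k" "GL \<subseteq> S'" "serves cap S ls k' S'"
proof -
  have "\<exists>k' S'. k' \<le> k \<and> GL \<subseteq> S' \<and> serves cap S ls k' S'"
    using assms by (simp add: serve_cost_def)
  then show ?thesis using that by blast
qed

lemma serve_cost_Nil: "serve_cost GL cap [] 0"
  unfolding serve_cost_def using serves_Nil by blast

lemma serve_cost_mono: "serve_cost GL cap ls k \<Longrightarrow> k \<le> k' \<Longrightarrow> serve_cost GL cap ls k'"
  unfolding serve_cost_def using le_trans by meson

lemma serve_cost_append:
  assumes "serve_cost GL cap ls k" "serve_cost GL cap ls' k'"
  shows "serve_cost GL cap (ls @ ls') (k + k')"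
  unfolding serve_cost_def
proof (intro allI impI)
  fix S :: "addr set" assume "finite S" "GL \<subseteq> S" "card S \<le> cap"
  with assms(1) obtain k1 S1 where 1: "k1 \<le> k" "GL \<subseteq> S1" "serves cap S ls k1 S1"
    by (rule serve_costE)
  then have fin: "finite S1" and card: "card S1 \<le> cap" by (auto simp: serves_def)
  from assms(2) fin 1(2) card obtain k2 S2 where 2: "k2 \<le> k'" "GL \<subseteq> S2" "serves cap S1 ls' k2 S2"
    by (rule serve_costE)
  have "k1 + k2 \<le> k + k'" using 1(1) 2(1) by simp
  then show "\<exists>k'' S'. k'' \<le> k + k' \<and> GL \<subseteq> S' \<and> serves cap S (ls @ ls') k'' S'"
    using 2(2) serves_append[OF 1(3) 2(3)] by blast
qed

text \<open>After the first request only lines of \<open>GL \<union> E\<close> are kept, and each miss adds a new line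
  of \<open>E\<close> to the cache.\<close>

lemma serve_cost_lines:
  assumes "set ls \<subseteq> GL \<union> E" "finite GL" "finite E" "card GL + card E \<le> cap"
  shows "serve_cost GL cap ls (card E)"
proof -
  have fin: "finite (GL \<union> E)" and card: "card (GL \<union> E) \<le> cap"
    using assms card_Un_le[of GL E] by auto
  have main: "\<exists>k' S'. k' \<le> card (E - S) \<and> GL \<subseteq> S' \<and> serves cap S ls k' S'"
    if "finite S" "GL \<subseteq> S" "card S \<le> cap" "set ls \<subseteq> GL \<union> E" for S
    using that
  proof (induction ls arbitrary: S)
    case Nil
    then show ?case using serves_Nil by blast
  next
    case (Cons l ls)
    define T where "T = insert l S \<inter> (GL \<union> E)"
    have T: "l \<in> T" "T \<subseteq> insert l S" "finite T" "GL \<subseteq> T"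
      using Cons.prems fin by (auto simp: T_def)
    have cT: "card T \<le> cap"
      using card card_mono[OF fin, of T] by (auto simp: T_def)
    have "set ls \<subseteq> GL \<union> E" using Cons.prems by simp
    then obtain k' S' where k': "k' \<le> card (E - T)" "GL \<subseteq> S'" "serves cap T ls k' S'"
      using Cons.IH[OF T(3,4) cT] by blast
    have "(if l \<in> S then 0 else 1) + k' \<le> card (E - S)"
    proof (cases "l \<in> S")
      case True
      then have "E - T = E - S" by (auto simp: T_def)
      then show ?thesis using True k' by simp
    next
      case False
      then have "E - S = insert l (E - T)" "l \<notin> E - T"
        using Cons.prems by (auto simp: T_def)
      then show ?thesis using False k' assms(3) by simp
    qed
    then show ?case using k'(2) serves_Cons[OF T(1-3) cT k'(3)] by blast
  qed
  show ?thesis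
    unfolding serve_cost_def
  proof (intro allI impI)
    fix S :: "addr set" assume S: "finite S" "GL \<subseteq> S" "card S \<le> cap"
    have "card (E - S) \<le> card E"
      using assms(3) by (intro card_mono) auto
    then show "\<exists>k' S'. k' \<le> card E \<and> GL \<subseteq> S' \<and> serves cap S ls k' S'"
      using main[OF S assms(1)] le_trans by blast
  qed
qed

text \<open>The initial cache may hold any globals that fit, so the run is started with exactly the
  pinned lines, whose loading is thereby free.\<close>

lemma opt_misses_le:
  assumes "serve_cost GL cap ls k" "GL \<subseteq> range Glob" "finite GL" "card GL \<le> cap"
  shows "opt_misses cap ls \<le> k"
proof -
  from assms(1,3) order.refl assms(4) obtain k' S' where k': "k' \<le> k" "serves cap GL ls k' S'"
    by (rule serve_costE)
  have "cache_run cap GL ls k'"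
    using k'(2) cache_run.finish[of cap S'] unfolding serves_def
    by (metis add.right_neutral append_Nil2)
  then have "opt_misses cap ls \<le> k'"
    unfolding opt_misses_def using assms by (intro Least_le) auto
  then show ?thesis using k' by simp
qed

section \<open>Strands of a computation under arbitrary schedules\<close>

fun strands :: "item list \<Rightarrow> op list list" where
  "strands [] = [[]]"
| "strands (Step a # t) = (a # hd (strands t)) # tl (strands t)"
| "strands (Fork l r # t) = [] # strands l @ strands r @ strands t"

lemma strands_ne [simp]: "strands t \<noteq> []"
  by (induction t rule: strands.induct) auto

lemma strands_map_Step: "strands (map Step ops @ t) = (ops @ hd (strands t)) # tl (strands t)"
  by (induction ops) auto

lemma mset_shuffles: "zs \<in> shuffles xs ys \<Longrightarrow> mset zs = mset xs + mset ys"
  by (induction xs ys arbitrary: zs rule: shuffles.induct) auto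

text \<open>A schedule only reorders strands and assigns processors, so their multiset is an
  invariant. For this to be exact, \<open>strands\<close> keeps empty runs, just as
  \<open>schedule\<close> emits a possibly empty strand before each fork and at the end of each
  branch.\<close>

lemma schedule_strands: "schedule t \<sigma> \<Longrightarrow> image_mset snd (mset \<sigma>) = mset (strands t)"
proof (induction rule: schedule.induct)
  case (strand ops p)
  then show ?case using strands_map_Step[of ops "[]"] by simp
next
  case (fork l us r vs ws t zs ops p)
  then show ?case by (simp add: strands_map_Step mset_shuffles)
qed

text \<open>\<open>k\<close> bounds the misses when the strands of the computation are split into pieces that are
  served independently.\<close>

inductive comp_cost :: "addr set \<Rightarrow> nat \<Rightarrow> nat \<Rightarrow> item list \<Rightarrow> nat \<Rightarrow> bool" for GL cap b where
  nil: "comp_cost GL cap b [] 0"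
| steps: "serve_cost GL cap (lines b ops) k \<Longrightarrow> comp_cost GL cap b t k' \<Longrightarrow>
    comp_cost GL cap b (map Step ops @ t) (k + k')"
| fork: "comp_cost GL cap b l k \<Longrightarrow> comp_cost GL cap b r k' \<Longrightarrow> comp_cost GL cap b t k'' \<Longrightarrow>
    comp_cost GL cap b (Fork l r # t) (k + k' + k'')"

lemma comp_cost_append:
  "comp_cost GL cap b t k \<Longrightarrow> comp_cost GL cap b t' k' \<Longrightarrow> comp_cost GL cap b (t @ t') (k + k')"
proof (induction rule: comp_cost.induct)
  case nil
  then show ?case by simp
next
  case (steps ops k t k'')
  then show ?case using comp_cost.steps[OF steps(1) steps(3)[OF steps(4)]] by (simp add: add.assoc)
next
  case (fork l k r k' t k'')
  then show ?case
    using comp_cost.fork[OF fork(1,2) fork.IH(3)[OF fork.prems]] by (simp add: add.assoc)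
qed

lemma lines_append: "lines b (xs @ ys) = lines b xs @ lines b ys"
  by (induction b xs rule: lines.induct) auto

text \<open>The pieces of \<open>comp_cost\<close> need not be whole strands, since series
  composition joins the last run of one program to the first run of the next. Costs of adjacent
  pieces add within the strand that they form.\<close>

lemma comp_cost_strands:
  "comp_cost GL cap b t k \<Longrightarrow>
    \<exists>ks. list_all2 (serve_cost GL cap) (map (lines b) (strands t)) ks \<and> sum_list ks = k"
proof (induction rule: comp_cost.induct)
  case nil
  then show ?case using serve_cost_Nil[of GL cap] by (intro exI[of _ "[0]"]) simp
next
  case (steps ops k t k')
  then obtain ks where ks: "list_all2 (serve_cost GL cap) (map (lines b) (strands t)) ks"
    "sum_list ks = k'" by blast
  obtain s ss where s: "strands t = s # ss" using strands_ne by (cases "strands t") auto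
  with ks obtain k1 ks' where "ks = k1 # ks'" "serve_cost GL cap (lines b s) k1"
    "list_all2 (serve_cost GL cap) (map (lines b) ss) ks'"
    by (auto simp: list_all2_Cons1)
  then show ?case using ks(2) s serve_cost_append[OF steps(1)]
    by (intro exI[of _ "(k + k1) # ks'"]) (auto simp: strands_map_Step lines_append)
next
  case (fork l k r k' t k'')
  then obtain k1 k2 k3 where
    "list_all2 (serve_cost GL cap) (map (lines b) (strands l)) k1" "sum_list k1 = k"
    "list_all2 (serve_cost GL cap) (map (lines b) (strands r)) k2" "sum_list k2 = k'"
    "list_all2 (serve_cost GL cap) (map (lines b) (strands t)) k3" "sum_list k3 = k''" by blast
  then show ?case using serve_cost_Nil[of GL cap]
    by (intro exI[of _ "0 # k1 @ k2 @ k3"]) (auto intro!: list_all2_appendI)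
qed

lemma sum_list_filter_fst:
  fixes w :: "'b \<Rightarrow> nat"
  assumes "finite F" "fst ` set zs \<subseteq> F"
  shows "(\<Sum>p\<in>F. \<Sum>z\<leftarrow>filter (\<lambda>z. fst z = p) zs. w (snd z)) = (\<Sum>z\<leftarrow>zs. w (snd z))"
  using assms(2)
proof (induction zs)
  case (Cons z zs)
  have "(\<Sum>p\<in>F. \<Sum>z\<leftarrow>filter (\<lambda>z. fst z = p) (z # zs). w (snd z)) =
    (\<Sum>p\<in>F. (if fst z = p then w (snd z) else 0) + (\<Sum>z\<leftarrow>filter (\<lambda>z. fst z = p) zs. w (snd z)))"
    by (rule sum.cong) simp_all
  also have "\<dots> = w (snd z) + (\<Sum>z\<leftarrow>zs. w (snd z))"
    using Cons assms(1) by (simp add: sum.distrib)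
  finally show ?case by simp
qed simp

text \<open>Each processor executes a sequence of strands, and \<open>serve_cost\<close> of a strand
  holds for whatever the previous strands left in the cache, as long as the pinned lines are
  present. Hence costs add over strands, however these are distributed and interleaved.\<close>

lemma cache_misses_le:
  assumes "schedule t \<sigma>" "comp_cost GL cap b t k"
    "GL \<subseteq> range Glob" "finite GL" "card GL \<le> cap"
  shows "cache_misses b cap \<sigma> \<le> k"
proof -
  \<comment> \<open>Equal strands may carry different bounds in \<open>ks\<close>. The least bound
    depends on the strand alone, so its sum is determined by the multiset of strands.\<close>
  define w where "w ops = (LEAST k. serve_cost GL cap (lines b ops) k)" for ops
  obtain ks where ks: "list_all2 (serve_cost GL cap) (map (lines b) (strands t)) ks"
    "sum_list ks = k" using comp_cost_strands[OF assms(2)] by blast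
  have w: "serve_cost GL cap (lines b ops) (w ops)" if "serve_cost GL cap (lines b ops) k" for ops k
    unfolding w_def using that by (rule LeastI)
  have w_le: "w ops \<le> k" if "serve_cost GL cap (lines b ops) k" for ops k
    unfolding w_def using that by (rule Least_le)
  have strand: "serve_cost GL cap (lines b ops) (w ops)" if "ops \<in> set (strands t)" for ops
  proof -
    from that obtain i where "i < length (strands t)" "strands t ! i = ops"
      by (auto simp: in_set_conv_nth)
    then show ?thesis using ks(1) w by (auto simp: list_all2_conv_all_nth)
  qed
  have "sum_list (map w xs) \<le> sum_list ks"
    if "list_all2 (serve_cost GL cap) (map (lines b) xs) ks" for xs ks
    using that by (induction xs arbitrary: ks) (auto simp: list_all2_Cons1 intro!: add_mono w_le)
  then have sum: "sum_list (map w (strands t)) \<le> k" using ks by auto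
  have ms: "image_mset snd (mset \<sigma>) = mset (strands t)"
    using assms(1) by (rule schedule_strands)
  then have set: "snd ` set \<sigma> = set (strands t)"
    by (metis set_image_mset set_mset_mset)
  have concat: "serve_cost GL cap (lines b (concat (map snd zs))) (\<Sum>z\<leftarrow>zs. w (snd z))"
    if "set zs \<subseteq> set \<sigma>" for zs
    using that
  proof (induction zs)
    case Nil
    then show ?case by (simp add: serve_cost_Nil)
  next
    case (Cons z zs)
    then have "snd z \<in> set (strands t)" using set by auto
    then show ?case using Cons strand by (simp add: lines_append serve_cost_append)
  qed
  have "cache_misses b cap \<sigma>
      \<le> (\<Sum>p\<in>fst ` set \<sigma>. \<Sum>z\<leftarrow>filter (\<lambda>z. fst z = p) \<sigma>. w (snd z))"
    unfolding cache_misses_def proc_lines_def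
    by (intro sum_mono opt_misses_le[OF concat assms(3-5)]) auto
  also have "\<dots> = (\<Sum>z\<leftarrow>\<sigma>. w (snd z))"
    by (rule sum_list_filter_fst) auto
  also have "\<dots> = sum_mset (image_mset w (image_mset snd (mset \<sigma>)))"
    by (induction \<sigma>) auto
  also have "\<dots> = sum_mset (image_mset w (mset (strands t)))"
    by (simp only: ms)
  also have "\<dots> = sum_list (map w (strands t))"
    by (simp only: sum_mset_sum_list flip: mset_map)
  finally show ?thesis using sum by simp
qed

section \<open>Serial partition\<close>

definition accessed :: "op list \<Rightarrow> addr set" where
  "accessed ops = {a. Access a \<in> set ops}"

lemma accessed_simps [simp]:
  "accessed [] = {}" "accessed (Local # ops) = accessed ops"
  "accessed (Access a # ops) = insert a (accessed ops)"
  "accessed (xs @ ys) = accessed xs \<union> accessed ys"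
  by (auto simp: accessed_def)

lemma set_lines: "set (lines b ops) = line_of b ` accessed ops"
  by (induction b ops rule: lines.induct) auto

lemma comp_work_append [simp]: "comp_work (t @ t') = comp_work t + comp_work t'"
  by (induction t rule: comp_work.induct) auto

lemma comp_span_append [simp]: "comp_span (t @ t') = comp_span t + comp_span t'"
  by (induction t rule: comp_span.induct) auto

lemma comp_work_map_Step [simp]: "comp_work (map Step ops) = length ops"
  by (induction ops) auto

lemma comp_span_map_Step [simp]: "comp_span (map Step ops) = length ops"
  by (induction ops) auto

text \<open>An iteration of the two-pointer loop costs at most 10: two positions of at most 2 steps
  each, two reads, two tests, two writes. \<open>G\<close> holds what the position computations
  touch, so that one statement serves both the strides, which look up \<open>X\<close>, and
  contiguous ranges. The count refers to the input array: a swap changes only the two positions that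
  leave the range, because \<open>f\<close> is injective.\<close>

lemma serial_partition_spec:
  fixes A :: "'e list"
  assumes pos: "\<And>j A. lo \<le> j \<Longrightarrow> j < hi \<Longrightarrow> pos j A = (f j, A, map Step (tr j))"
    and len: "\<And>j. lo \<le> j \<Longrightarrow> j < hi \<Longrightarrow> length (tr j) \<le> 2"
    and acc: "\<And>j. lo \<le> j \<Longrightarrow> j < hi \<Longrightarrow> accessed (tr j) \<subseteq> G"
    and inj: "inj_on f {lo..<hi}"
    and bound: "\<And>j. lo \<le> j \<Longrightarrow> j < hi \<Longrightarrow> base + f j < length A"
    and res: "serial_partition P base pos lo hi A = (v, A', t)"
  shows "v = lo + card {j\<in>{lo..<hi}. P (A ! (base + f j))} \<and> length A' = length A \<and>
    (\<forall>x. x \<notin> (\<lambda>j. base + f j) ` {lo..<hi} \<longrightarrow> A' ! x = A ! x) \<and>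
    (\<exists>ops. t = map Step ops \<and> length ops \<le> 10 * (hi - lo) \<and>
      accessed ops \<subseteq> G \<union> Elem ` (\<lambda>j. base + f j) ` {lo..<hi})"
  using assms
proof (induction "hi - lo" arbitrary: lo hi A v A' t rule: less_induct)
  case less
  show ?case
  proof (cases "lo < hi")
    case False
    then have "v = lo" "A' = A" "t = []"
      using less.prems(6) by (auto simp: serial_partition.simps[of P base pos lo hi] ret_def)
    then show ?thesis using False by (auto intro!: exI[of _ "[]"])
  next
    case True
    define x where "x = A ! (base + f lo)"
    define y where "y = A ! (base + f (hi - 1))"
    define Z where "Z l h = (\<lambda>j. base + f j) ` {l..<h}" for l h :: nat
    note pos_lo = less.prems(1)[OF order.refl True]
    have hi1: "lo \<le> hi - 1" "hi - 1 < hi" using True by auto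
    note pos_hi = less.prems(1)[OF hi1]
    have inj': "inj_on f {l..<h}" if "lo \<le> l" "h \<le> hi" for l h
      using less.prems(4) by (rule inj_on_subset) (use that in auto)
    have Zsub: "Z l h \<subseteq> Z lo hi" if "lo \<le> l" "h \<le> hi" for l h
      unfolding Z_def using that by (intro image_mono) auto
    have f_eq: "f j = f j' \<longleftrightarrow> j = j'" if "lo \<le> j" "j < hi" "lo \<le> j'" "j' < hi" for j j'
      using less.prems(4) that by (auto simp: inj_on_def)
    have endpoints: "base + f lo \<in> Z lo hi" "base + f (hi - 1) \<in> Z lo hi"
      using True by (auto simp: Z_def)
    note acc_lo = less.prems(3)[OF order.refl True] and acc_hi = less.prems(3)[OF hi1]
    note len_lo = less.prems(2)[OF order.refl True] and len_hi = less.prems(2)[OF hi1]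
    have card_split_lo: "card {j\<in>{lo..<hi}. Q j} = (if Q lo then 1 else 0) + card {j\<in>{lo+1..<hi}. Q j}"
      for Q
    proof -
      have "{j\<in>{lo..<hi}. Q j} = (if Q lo then {lo} else {}) \<union> {j\<in>{lo+1..<hi}. Q j}"
        using True by (auto simp: Suc_le_eq order_le_less)
      then show ?thesis by (auto simp: card_insert_if)
    qed
    have card_split_hi: "card {j\<in>{l..<hi}. Q j} = (if Q (hi - 1) then 1 else 0) + card {j\<in>{l..<hi-1}. Q j}"
      if "l < hi" for Q l
    proof -
      have "{j\<in>{l..<hi}. Q j} = (if Q (hi - 1) then {hi - 1} else {}) \<union> {j\<in>{l..<hi-1}. Q j}"
        using that by (auto simp: order_le_less) (metis Suc_pred gr_implies_not0 less_Suc_eq not_gr_zero)+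
      then show ?thesis by (auto simp: card_insert_if)
    qed
    show ?thesis
    proof (cases "P x")
      case px: True
      obtain v1 A1 t1 where r: "serial_partition P base pos (lo + 1) hi A = (v1, A1, t1)"
        by (metis prod_cases3)
      have eq: "v = v1" "A' = A1"
        "t = map Step (tr lo @ [Access (Elem (base + f lo)), Local]) @ t1"
        using less.prems(6) True px r
        by (auto simp: serial_partition.simps[of P base pos lo hi] bind_prog_def pos_lo
            read_elem_def compute_def x_def)
      have "v1 = lo + 1 + card {j\<in>{lo+1..<hi}. P (A ! (base + f j))} \<and> length A1 = length A \<and>
        (\<forall>x. x \<notin> Z (lo+1) hi \<longrightarrow> A1 ! x = A ! x) \<and>
        (\<exists>ops. t1 = map Step ops \<and> length ops \<le> 10 * (hi - (lo+1)) \<and>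
          accessed ops \<subseteq> G \<union> Elem ` Z (lo+1) hi)"
        unfolding Z_def
        by (rule less.hyps) (use True less.prems r inj' in auto)
      then obtain ops where IH: "v1 = lo + 1 + card {j\<in>{lo+1..<hi}. P (A ! (base + f j))}"
        "length A1 = length A" "\<And>x. x \<notin> Z (lo+1) hi \<Longrightarrow> A1 ! x = A ! x"
        "t1 = map Step ops" "length ops \<le> 10 * (hi - (lo+1))"
        "accessed ops \<subseteq> G \<union> Elem ` Z (lo+1) hi" by blast
      have "t = map Step (tr lo @ [Access (Elem (base + f lo)), Local] @ ops)"
        using eq IH(4) by simp
      moreover have "accessed (tr lo @ [Access (Elem (base + f lo)), Local] @ ops)
          \<subseteq> G \<union> Elem ` Z lo hi"
        using IH(6) acc_lo endpoints Zsub[of "lo+1" hi] by auto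
      moreover have "length (tr lo @ [Access (Elem (base + f lo)), Local] @ ops) \<le> 10 * (hi - lo)"
        using IH(5) len_lo True by simp
      moreover have "v = lo + card {j\<in>{lo..<hi}. P (A ! (base + f j))}"
        using eq IH(1) px card_split_lo by (simp add: x_def)
      moreover have "\<forall>x. x \<notin> Z lo hi \<longrightarrow> A' ! x = A ! x"
        using IH(3) eq Zsub[of "lo+1" hi] by auto
      ultimately show ?thesis using IH(2) eq unfolding Z_def by blast
    next
      case px: False
      define pre where "pre = tr lo @ [Access (Elem (base + f lo)), Local] @ tr (hi - 1) @
        [Access (Elem (base + f (hi - 1))), Local]"
      have pre: "length pre \<le> 8" "accessed pre \<subseteq> G \<union> Elem ` Z lo hi"
        using len_lo len_hi acc_lo acc_hi endpoints by (auto simp: pre_def)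
      show ?thesis
      proof (cases "P y")
        case py: True
        \<comment> \<open>Equality would give \<open>x = y\<close> with opposite test results, so a
          swap always removes two distinct positions.\<close>
        have lohi: "lo < hi - 1" using px py True unfolding x_def y_def
          by (metis hi1(1) order_le_less)
        define B where "B = A[base + f lo := y, base + f (hi - 1) := x]"
        have B_nth: "B ! (base + f j) = A ! (base + f j)" if "lo + 1 \<le> j" "j < hi - 1" for j
        proof -
          have "f j \<noteq> f lo" "f j \<noteq> f (hi - 1)"
            using that True f_eq[of j lo] f_eq[of j "hi - 1"] by linarith+
          then show ?thesis by (simp add: B_def)
        qed
        have B_other: "B ! z = A ! z" if "z \<notin> Z lo hi" for z
          using that endpoints unfolding B_def by (metis nth_list_update_neq)
        obtain v1 A1 t1 where r: "serial_partition P base pos (lo + 1) (hi - 1) B = (v1, A1, t1)"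
          by (metis prod_cases3)
        have eq: "v = v1" "A' = A1"
          "t = map Step (pre @ [Access (Elem (base + f lo)), Access (Elem (base + f (hi - 1)))]) @ t1"
          using less.prems(6) True px py r
          by (auto simp: serial_partition.simps[of P base pos lo hi] bind_prog_def pos_lo pos_hi pos_hi[simplified]
              read_elem_def compute_def write_elem_def x_def y_def B_def pre_def)
        have "v1 = lo + 1 + card {j\<in>{lo+1..<hi-1}. P (B ! (base + f j))} \<and> length A1 = length B \<and>
          (\<forall>x. x \<notin> Z (lo+1) (hi-1) \<longrightarrow> A1 ! x = B ! x) \<and>
          (\<exists>ops. t1 = map Step ops \<and> length ops \<le> 10 * ((hi-1) - (lo+1)) \<and>
            accessed ops \<subseteq> G \<union> Elem ` Z (lo+1) (hi-1))"
          unfolding Z_def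
          by (rule less.hyps) (use True less.prems r inj' in \<open>auto simp: B_def\<close>)
        then obtain ops where IH: "v1 = lo + 1 + card {j\<in>{lo+1..<hi-1}. P (B ! (base + f j))}"
          "length A1 = length B" "\<And>x. x \<notin> Z (lo+1) (hi-1) \<Longrightarrow> A1 ! x = B ! x"
          "t1 = map Step ops" "length ops \<le> 10 * ((hi-1) - (lo+1))"
          "accessed ops \<subseteq> G \<union> Elem ` Z (lo+1) (hi-1)" by blast
        let ?ops = "pre @ [Access (Elem (base + f lo)), Access (Elem (base + f (hi - 1)))] @ ops"
        have "t = map Step ?ops"
          using eq IH(4) by simp
        moreover have "accessed ?ops \<subseteq> G \<union> Elem ` Z lo hi"
          using IH(6) pre(2) endpoints Zsub[of "lo+1" "hi-1"] by auto
        moreover have "length ?ops \<le> 10 * (hi - lo)"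
          using IH(5) pre(1) lohi by simp
        moreover have "{j\<in>{lo+1..<hi-1}. P (B ! (base + f j))} = {j\<in>{lo+1..<hi-1}. P (A ! (base + f j))}"
          using B_nth by auto
        then have "v = lo + card {j\<in>{lo..<hi}. P (A ! (base + f j))}"
          using eq IH(1) px py lohi card_split_lo card_split_hi[of "lo + 1"]
          by (simp add: x_def y_def)
        moreover have "A' ! z = A ! z" if "z \<notin> Z lo hi" for z
          using that IH(3)[of z] eq(2) Zsub[of "lo+1" "hi-1"] B_other[OF that] by auto
        moreover have "length A' = length A" using IH(2) eq by (simp add: B_def)
        ultimately show ?thesis unfolding Z_def by blast
      next
        case py: False
        obtain v1 A1 t1 where r: "serial_partition P base pos lo (hi - 1) A = (v1, A1, t1)"
          by (metis prod_cases3)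
        have eq: "v = v1" "A' = A1" "t = map Step pre @ t1"
          using less.prems(6) True px py r
          by (auto simp: serial_partition.simps[of P base pos lo hi] bind_prog_def pos_lo pos_hi pos_hi[simplified]
              read_elem_def compute_def x_def y_def pre_def)
        have "v1 = lo + card {j\<in>{lo..<hi-1}. P (A ! (base + f j))} \<and> length A1 = length A \<and>
          (\<forall>x. x \<notin> Z lo (hi-1) \<longrightarrow> A1 ! x = A ! x) \<and>
          (\<exists>ops. t1 = map Step ops \<and> length ops \<le> 10 * ((hi-1) - lo) \<and>
            accessed ops \<subseteq> G \<union> Elem ` Z lo (hi-1))"
          unfolding Z_def
          by (rule less.hyps) (use True less.prems r inj' in auto)
        then obtain ops where IH: "v1 = lo + card {j\<in>{lo..<hi-1}. P (A ! (base + f j))}"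
          "length A1 = length A" "\<And>x. x \<notin> Z lo (hi-1) \<Longrightarrow> A1 ! x = A ! x"
          "t1 = map Step ops" "length ops \<le> 10 * ((hi-1) - lo)"
          "accessed ops \<subseteq> G \<union> Elem ` Z lo (hi-1)" by blast
        have "t = map Step (pre @ ops)"
          using eq IH(4) by simp
        moreover have "accessed (pre @ ops) \<subseteq> G \<union> Elem ` Z lo hi"
          using IH(6) pre(2) Zsub[of lo "hi-1"] by auto
        moreover have "length (pre @ ops) \<le> 10 * (hi - lo)"
          using IH(5) pre(1) True by simp
        moreover have "v = lo + card {j\<in>{lo..<hi}. P (A ! (base + f j))}"
          using eq IH(1) py True card_split_hi[of lo] by (simp add: y_def)
        moreover have "\<forall>x. x \<notin> Z lo hi \<longrightarrow> A' ! x = A ! x"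
          using IH(3) eq Zsub[of lo "hi-1"] by auto
        ultimately show ?thesis using IH(2) eq unfolding Z_def by blast
      qed
    qed
  qed
qed

section \<open>The strides\<close>

definition stride_line :: "nat \<Rightarrow> (nat \<Rightarrow> nat) \<Rightarrow> nat \<Rightarrow> nat \<Rightarrow> nat" where
  "stride_line g X i j = (X j + i) mod g + j * g"

definition stride_idx :: "nat \<Rightarrow> nat \<Rightarrow> (nat \<Rightarrow> nat) \<Rightarrow> nat \<Rightarrow> nat \<Rightarrow> nat" where
  "stride_idx b g X i k = stride_line g X i (k div b) * b + k mod b"

text \<open>Truncated subtraction yields 0 when the last line of the stride lies entirely in the
  padding.\<close>

definition stride_len :: "nat \<Rightarrow> nat \<Rightarrow> nat \<Rightarrow> (nat \<Rightarrow> nat) \<Rightarrow> nat \<Rightarrow> nat \<Rightarrow> nat" where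
  "stride_len b g s X m i = (s - 1) * b + min b (m - stride_line g X i (s - 1) * b)"

lemma stride_pos_eq:
  "stride_pos b g X i k A =
    (stride_idx b g X i k, A, map Step [Access (Glob (k div b)), Local])"
  by (simp add: stride_pos_def stride_idx_def stride_line_def bind_prog_def read_X_def compute_def)

text \<open>The index has the digits \<open>k mod b\<close>, \<open>(X j + i) mod g\<close> and
  \<open>j = k div b\<close> in the mixed radix with bases \<open>b\<close> and \<open>g\<close>, so
  it determines all three. The same \<open>X j\<close> then stands on both sides, and only the
  shifts \<open>i\<close> and \<open>i'\<close> remain to be compared.\<close>

lemma stride_idx_eqD:
  assumes "stride_idx b g X i k = stride_idx b g X i' k'" "0 < b" "0 < g"
  shows "k = k'" "(X (k div b) + i) mod g = (X (k div b) + i') mod g"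
proof -
  have "stride_idx b g X i k div b = stride_idx b g X i' k' div b"
    "stride_idx b g X i k mod b = stride_idx b g X i' k' mod b"
    using assms(1) by auto
  then have *: "stride_line g X i (k div b) = stride_line g X i' (k' div b)" "k mod b = k' mod b"
    using assms(2) by (auto simp: stride_idx_def)
  have "stride_line g X i (k div b) div g = stride_line g X i' (k' div b) div g"
    "stride_line g X i (k div b) mod g = stride_line g X i' (k' div b) mod g"
    using *(1) by auto
  then have "k div b = k' div b"
    "(X (k div b) + i) mod g = (X (k' div b) + i') mod g"
    using assms(3) by (auto simp: stride_line_def)
  then show "k = k'" "(X (k div b) + i) mod g = (X (k div b) + i') mod g"
    using *(2) by (metis div_mult_mod_eq, simp)
qed

lemma add_mod_inj:
  fixes x i i' g :: nat
  assumes "(x + i) mod g = (x + i') mod g" "i \<in> {1..g}" "i' \<in> {1..g}"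
  shows "i = i'"
proof (rule ccontr)
  have *: False if "(x + i) mod g = (x + i') mod g" "1 \<le> i" "i < i'" "i' \<le> g" for i i'
  proof -
    have "g dvd (x + i') - (x + i)"
      using that mod_eq_dvd_iff_nat[of "x + i" "x + i'" g] by simp
    then have "g \<le> i' - i" using that by (intro dvd_imp_le) auto
    then show False using that by linarith
  qed
  assume "i \<noteq> i'"
  then show False
    using *[of i i'] *[of i' i] assms by (cases i i' rule: linorder_cases) auto
qed

lemma stride_line_bounds:
  assumes "0 < g"
  shows "j * g \<le> stride_line g X i j" "stride_line g X i j < j * g + g"
  using assms by (auto simp: stride_line_def)

lemma stride_idx_bounds:
  assumes "0 < b" "0 < g"
  shows "k div b * g * b \<le> stride_idx b g X i k" "stride_idx b g X i k < k div b * g * b + g * b"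
proof -
  note l = stride_line_bounds[OF assms(2), where j = "k div b" and X = X and i = i]
  show "k div b * g * b \<le> stride_idx b g X i k"
    using mult_le_mono1[OF l(1), of b] unfolding stride_idx_def by linarith
  have "(stride_line g X i (k div b) + 1) * b \<le> (k div b * g + g) * b"
    using l(2) by (intro mult_le_mono1) simp
  moreover have "k mod b < b" using assms by simp
  ultimately show "stride_idx b g X i k < k div b * g * b + g * b"
    unfolding stride_idx_def by (simp add: add_mult_distrib)
qed

text \<open>The bound on \<open>m\<close> says that all groups but the last lie inside the array.
  Padding can thus cut off only the tail of the last block, and an index of an existing block
  denotes an actual element exactly when its array index is below \<open>m\<close>.\<close>

lemma less_stride_len_iff:
  assumes b: "0 < b" and g: "0 < g" and s: "0 < s" and m: "(s - 1) * g * b < m"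
  shows "k < stride_len b g s X m i \<longleftrightarrow> k div b < s \<and> stride_idx b g X i k < m"
proof -
  have len: "(s - 1) * b \<le> stride_len b g s X m i" "stride_len b g s X m i \<le> (s - 1) * b + b"
    by (auto simp: stride_len_def)
  have k: "k = k div b * b + k mod b" "k mod b < b" using b by auto
  consider "k div b < s - 1" | "k div b = s - 1" | "s \<le> k div b" by linarith
  then show ?thesis
  proof cases
    case 1
    have "(k div b + 1) * b \<le> (s - 1) * b" using 1 by (intro mult_le_mono1) simp
    then have "k div b * b + b \<le> (s - 1) * b" by (simp add: add_mult_distrib)
    then have "k < (s - 1) * b" using k by linarith
    moreover have "(k div b * g + g) * b \<le> (s - 1) * g * b"
    proof -
      have "k div b * g + g = (k div b + 1) * g" by simp
      also have "\<dots> \<le> (s - 1) * g" using 1 by (intro mult_le_mono1) simp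
      finally show ?thesis by (rule mult_le_mono1)
    qed
    then have "stride_idx b g X i k < m"
      using stride_idx_bounds(2)[OF b g, where k = k and X = X and i = i] m by (simp add: add_mult_distrib)
    ultimately show ?thesis using 1 len by auto
  next
    case 2
    have kk: "k = (s - 1) * b + k mod b" using k(1) 2 by metis
    have "k < stride_len b g s X m i \<longleftrightarrow> k mod b < min b (m - stride_line g X i (s - 1) * b)"
      unfolding stride_len_def by (subst (1) kk) simp
    also have "\<dots> \<longleftrightarrow> stride_idx b g X i k < m"
      unfolding stride_idx_def 2 using k(2) by auto
    finally show ?thesis using 2 s by simp
  next
    case 3
    have "s * b \<le> k div b * b" using 3 by (rule mult_le_mono1)
    moreover have "(s - 1) * b + b = s * b" using s by (cases s) auto
    ultimately show ?thesis using len k(1) 3 by linarith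
  qed
qed

definition stride_region :: "nat \<Rightarrow> nat \<Rightarrow> nat \<Rightarrow> (nat \<Rightarrow> nat) \<Rightarrow> nat \<Rightarrow> nat \<Rightarrow> nat \<Rightarrow> nat set" where
  "stride_region b g s X base m i = (\<lambda>k. base + stride_idx b g X i k) ` {0..<stride_len b g s X m i}"

definition stride_preds :: "('e \<Rightarrow> bool) \<Rightarrow> nat \<Rightarrow> nat \<Rightarrow> nat \<Rightarrow> (nat \<Rightarrow> nat) \<Rightarrow> nat \<Rightarrow> nat \<Rightarrow> nat \<Rightarrow> 'e list \<Rightarrow> nat" where
  "stride_preds P b g s X base m i A =
    card {k\<in>{0..<stride_len b g s X m i}. P (A ! (base + stride_idx b g X i k))}"

text \<open>A common index forces the same block, and within a block the rotation by
  \<open>X j\<close> is injective on \<open>{1..g}\<close>.\<close>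

lemma stride_regions_disjoint:
  assumes "0 < b" "0 < g" "i \<in> {1..g}" "i' \<in> {1..g}" "i \<noteq> i'"
  shows "stride_region b g s X base m i \<inter> stride_region b g s X base m i' = {}"
proof -
  have False if "stride_idx b g X i k = stride_idx b g X i' k'" for k k'
    using stride_idx_eqD(2)[OF that assms(1,2)] add_mod_inj assms(3-5) by blast
  then show ?thesis by (auto simp: stride_region_def)
qed

lemma partition_stride_eq:
  "partition_stride P b g s X base m i A =
    (case serial_partition P base (stride_pos b g X i) 0 (stride_len b g s X m i) A of (k, A1, t) \<Rightarrow>
      if k < stride_len b g s X m i then
        (stride_idx b g X i k, A1, map Step [Access (Glob (s - 1)), Local] @ t @
          map Step [Access (Glob (k div b)), Local])
      else (m, A1, map Step [Access (Glob (s - 1)), Local] @ t))"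
  by (simp add: partition_stride_def stride_len_def stride_line_def bind_prog_def read_X_def
      compute_def ret_def stride_pos_eq split: prod.split)

text \<open>With \<open>K\<close> predecessors, the first successor after the partition is element
  \<open>K\<close> of the stride (counting from 0), so it lies in group \<open>K div b\<close>, a
  range of length \<open>g * b\<close>. The two bounds on \<open>v\<close> are loose enough to cover
  the default \<open>m\<close> of a stride without successors as well. The 4 extra steps compute the
  stride length and the final position.\<close>

lemma partition_stride_spec:
  assumes b: "0 < b" and g: "0 < g" and s: "0 < s"
    and m: "(s - 1) * g * b < m" "m \<le> g * b * s" and A: "base + m \<le> length A"
    and res: "partition_stride P b g s X base m i A = (v, A', t)"
  shows "v \<le> m \<and> v \<le> stride_preds P b g s X base m i A div b * g * b + g * b \<and>
    stride_preds P b g s X base m i A div b * g * b \<le> v + g * b \<and>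
    length A' = length A \<and> (\<forall>x. x \<notin> stride_region b g s X base m i \<longrightarrow> A' ! x = A ! x) \<and>
    (\<exists>ops. t = map Step ops \<and> length ops \<le> 10 * (s * b) + 4 \<and>
      accessed ops \<subseteq> Glob ` {..<s} \<union> Elem ` stride_region b g s X base m i)"
proof -
  define u where "u = stride_len b g s X m i"
  define R where "R = stride_region b g s X base m i"
  note iff = less_stride_len_iff[OF b g s m(1), of _ X i, folded u_def]
  obtain k A1 t1 where r: "serial_partition P base (stride_pos b g X i) 0 u A = (k, A1, t1)"
    by (metis prod_cases3)
  have "k = 0 + card {j\<in>{0..<u}. P (A ! (base + stride_idx b g X i j))} \<and> length A1 = length A \<and>
    (\<forall>x. x \<notin> (\<lambda>j. base + stride_idx b g X i j) ` {0..<u} \<longrightarrow> A1 ! x = A ! x) \<and>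
    (\<exists>ops. t1 = map Step ops \<and> length ops \<le> 10 * (u - 0) \<and>
      accessed ops \<subseteq> Glob ` {..<s} \<union> Elem ` (\<lambda>j. base + stride_idx b g X i j) ` {0..<u})"
  proof (rule serial_partition_spec)
    show "inj_on (stride_idx b g X i) {0..<u}"
      using stride_idx_eqD(1)[OF _ b g] by (auto simp: inj_on_def)
    show "base + stride_idx b g X i j < length A" if "j < u" for j
      using that A iff by (meson add_less_cancel_left less_le_trans)
    show "stride_pos b g X i j B =
        (stride_idx b g X i j, B, map Step [Access (Glob (j div b)), Local])" for j and B :: "'a list"
      by (rule stride_pos_eq)
    show "accessed [Access (Glob (j div b)), Local] \<subseteq> Glob ` {..<s}" if "j < u" for j
      using that iff by auto
    show "serial_partition P base (stride_pos b g X i) 0 u A = (k, A1, t1)" by (rule r)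
  qed simp
  then obtain ops where IH: "k = stride_preds P b g s X base m i A" "length A1 = length A"
    "\<And>x. x \<notin> R \<Longrightarrow> A1 ! x = A ! x" "t1 = map Step ops" "length ops \<le> 10 * u"
    "accessed ops \<subseteq> Glob ` {..<s} \<union> Elem ` R"
    unfolding stride_preds_def u_def[symmetric] R_def stride_region_def by auto
  have "k \<le> card {0..<u}"
    unfolding IH(1) stride_preds_def u_def[symmetric] by (intro card_mono) auto
  then have k_le: "k \<le> u" by simp
  have sb: "(s - 1) * b + b = s * b" using s by (cases s) auto
  have u_le: "u \<le> s * b" "(s - 1) * b \<le> u" using sb by (auto simp: u_def stride_len_def)
  have t: "accessed ([Access (Glob (s - 1)), Local] @ ops) \<subseteq> Glob ` {..<s} \<union> Elem ` R"
    using IH(6) s by auto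
  show ?thesis
  proof (cases "k < u")
    case True
    have eq: "v = stride_idx b g X i k" "A' = A1"
      "t = map Step ([Access (Glob (s - 1)), Local] @ ops @ [Access (Glob (k div b)), Local])"
      using res r True IH(4) unfolding partition_stride_eq u_def[symmetric] by auto
    note kb = iff[THEN iffD1, OF True]
    have "accessed ([Access (Glob (s - 1)), Local] @ ops @ [Access (Glob (k div b)), Local])
        \<subseteq> Glob ` {..<s} \<union> Elem ` R"
      using t kb by auto
    moreover have "length ([Access (Glob (s - 1)), Local] @ ops @ [Access (Glob (k div b)), Local])
        \<le> 10 * (s * b) + 4"
      using IH(5) u_le by simp
    ultimately show ?thesis
      using IH(2,3) eq kb stride_idx_bounds[OF b g, where k = k and X = X and i = i] unfolding R_def IH(1)[symmetric]
      by (intro conjI exI[of _ "[Access (Glob (s - 1)), Local] @ ops @ [Access (Glob (k div b)), Local]"]) auto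
  next
    case False
    then have k: "k = u" using k_le by simp
    have eq: "v = m" "A' = A1" "t = map Step ([Access (Glob (s - 1)), Local] @ ops)"
      using res r False IH(4) unfolding partition_stride_eq u_def[symmetric] by auto
    \<comment> \<open>Without a successor \<open>k\<close> is the full stride length, between
      \<open>(s - 1) * b\<close> and \<open>s * b\<close>, so the boundary named by
      \<open>k div b\<close> is at most one group away from \<open>m\<close>.\<close>
    have "s - 1 \<le> k div b" "k div b \<le> s"
      using u_le b by (auto simp: k less_eq_div_iff_mult_less_eq div_le_mono dest: div_le_mono[of _ _ b])
    then have d: "(s - 1) * (g * b) \<le> k div b * (g * b)" "k div b * (g * b) \<le> s * (g * b)"
      by (auto intro: mult_le_mono1)
    have sg: "(s - 1) * (g * b) + g * b = s * (g * b)" using s by (cases s) auto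
    have m': "(s - 1) * (g * b) < m" "m \<le> s * (g * b)" using m by (simp_all add: ac_simps)
    have 1: "m \<le> k div b * g * b + g * b" "k div b * g * b \<le> m + g * b"
      unfolding mult.assoc using d sg m' by linarith+
    have "length ([Access (Glob (s - 1)), Local] @ ops) \<le> 10 * (s * b) + 4"
      using IH(5) u_le by simp
    then show ?thesis
      using IH(2,3) eq 1 t unfolding R_def IH(1)[symmetric]
      by (intro conjI exI[of _ "[Access (Glob (s - 1)), Local] @ ops"]) auto
  qed
qed

lemma div_add_cases:
  fixes a b q r :: nat
  assumes "0 < b" "r < b"
  shows "(a + (q * b + r)) div b \<in> {a div b + q, a div b + q + 1}"
    and "b dvd a \<Longrightarrow> (a + (q * b + r)) div b = a div b + q"
proof -
  have *: "(a + (q * b + r)) div b = q + (a + r) div b"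
    using assms by (metis add.left_commute div_mult_self3 less_numeral_extra(3))
  have "(a + r) div b \<le> (a + b) div b" "a div b \<le> (a + r) div b"
    using assms by (intro div_le_mono; simp)+
  moreover have "(a + b) div b = a div b + 1" using assms by simp
  ultimately show "(a + (q * b + r)) div b \<in> {a div b + q, a div b + q + 1}"
    unfolding * by (cases "(a + r) div b = a div b") auto
  assume "b dvd a"
  then show "(a + (q * b + r)) div b = a div b + q"
    using * assms by auto
qed

text \<open>Deeper subarrays start at \<open>base + vmin\<close>, possibly inside a cache line; each
  block of \<open>b\<close> elements may then meet two memory lines. The factor 1 at offset 0 is
  what the leading term of the miss bound relies on.\<close>

definition line_factor :: "nat \<Rightarrow> nat \<Rightarrow> nat" where
  "line_factor b base = (if b dvd base then 1 else 2)"

lemma stride_region_lines: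
  assumes "0 < b" "0 < g" "0 < s" "(s - 1) * g * b < m"
  obtains E where "line_of b ` Elem ` stride_region b g s X base m i \<subseteq> E"
    "finite E" "card E \<le> line_factor b base * s"
proof -
  let ?q = "stride_line g X i"
  have k: "k div b < s" if "k < stride_len b g s X m i" for k
    using that less_stride_len_iff[OF assms] by blast
  have line: "(base + stride_idx b g X i k) div b \<in> {base div b + ?q (k div b), base div b + ?q (k div b) + 1}"
    "b dvd base \<Longrightarrow> (base + stride_idx b g X i k) div b = base div b + ?q (k div b)" for k
    using div_add_cases[of b "k mod b" base "?q (k div b)"] assms by (auto simp: stride_idx_def)
  show ?thesis
  proof (cases "b dvd base")
    case True
    have "card ((\<lambda>j. Elem (base div b + ?q j)) ` {..<s}) \<le> s"
      using card_image_le[of "{..<s}"] by auto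
    then show ?thesis using True k line(2)
      by (intro that[of "(\<lambda>j. Elem (base div b + ?q j)) ` {..<s}"])
        (auto simp: stride_region_def line_factor_def)
  next
    case False
    let ?E = "(\<lambda>j. Elem (base div b + ?q j)) ` {..<s} \<union> (\<lambda>j. Elem (base div b + ?q j + 1)) ` {..<s}"
    have "card ?E \<le> s + s"
      by (rule order.trans[OF card_Un_le add_mono]) (auto intro: card_image_le[THEN order.trans])
    moreover have "line_of b ` Elem ` stride_region b g s X base m i \<subseteq> ?E"
      using k line(1) by (fastforce simp: stride_region_def)
    ultimately show ?thesis using False
      by (intro that[of ?E]) (auto simp: line_factor_def)
  qed
qed

section \<open>One level of the algorithm\<close>

text \<open>The body is specified only on arrays that agree with \<open>A0\<close> on its own region
  \<open>R i\<close>; disjointness keeps this true although the branches are evaluated one after the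
  other. A loop with h iterations has h leaves of work at most \<open>W + 1\<close> and h - 1 inner
  nodes of own work 3, in total at most (W + 4) h - 3. Writing the 3 on the left makes the bound
  additive under splitting.\<close>

lemma par_min_max_spec:
  assumes body: "\<And>i B v B' t. i0 \<le> i \<Longrightarrow> i < i1 \<Longrightarrow> length B = N \<Longrightarrow> \<forall>x\<in>R i. B ! x = A0 ! x \<Longrightarrow>
      body i B = (v, B', t) \<Longrightarrow>
      Q i v \<and> length B' = N \<and> (\<forall>x. x \<notin> R i \<longrightarrow> B' ! x = B ! x) \<and>
      (\<exists>ops. t = map Step ops \<and> length ops \<le> W \<and> serve_cost GL cap (lines b ops) D)"
    and disj: "\<And>i j. i0 \<le> i \<Longrightarrow> i < i1 \<Longrightarrow> i0 \<le> j \<Longrightarrow> j < i1 \<Longrightarrow> i \<noteq> j \<Longrightarrow> R i \<inter> R j = {}"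
    and "i0 \<le> lo" "lo < hi" "hi \<le> i1" "length A = N"
    and "\<And>i x. lo \<le> i \<Longrightarrow> i < hi \<Longrightarrow> x \<in> R i \<Longrightarrow> A ! x = A0 ! x"
    and "par_min_max body lo hi A = ((a, c), A', t)"
  shows "(\<exists>i\<in>{lo..<hi}. Q i a) \<and> (\<exists>i\<in>{lo..<hi}. Q i c) \<and> a \<le> c \<and> length A' = N \<and>
    (\<forall>x. x \<notin> \<Union> (R ` {lo..<hi}) \<longrightarrow> A' ! x = A ! x) \<and>
    comp_work t + 3 \<le> (W + 4) * (hi - lo) \<and>
    (\<forall>d. hi - lo \<le> 2 ^ d \<longrightarrow> comp_span t \<le> W + 1 + 3 * d) \<and>
    comp_cost GL cap b t (D * (hi - lo))"
  using assms(3-)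
proof (induction "hi - lo" arbitrary: lo hi A a c A' t rule: less_induct)
  case less
  have local: "serve_cost GL cap (lines b [Local]) 0" by (simp add: serve_cost_Nil)
  show ?case
  proof (cases "hi \<le> lo + 1")
    case True
    then have hi: "hi = lo + 1" using less.prems by simp
    obtain v B t1 where r: "body lo A = (v, B, t1)" by (metis prod_cases3)
    have eq: "a = v" "c = v" "A' = B" "t = t1 @ [Step Local]"
      using less.prems(6) True r
      by (auto simp: par_min_max.simps[of body lo hi] bind_prog_def compute_def)
    from body[OF less.prems(1) _ less.prems(4) _ r] less.prems(2,3,5)
    obtain ops where ops: "Q lo v" "length B = N" "\<forall>x. x \<notin> R lo \<longrightarrow> B ! x = A ! x"
      "t1 = map Step ops" "length ops \<le> W" "serve_cost GL cap (lines b ops) D"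
      by (auto simp: hi)
    have "comp_cost GL cap b t (D + (0 + 0))"
      using comp_cost.steps[OF ops(6) comp_cost.steps[OF local comp_cost.nil]] by (simp add: eq ops)
    then show ?thesis using ops by (simp add: hi eq)
  next
    case False
    define mid where "mid = (lo + hi) div 2"
    have mid: "lo < mid" "mid < hi" using False by (auto simp: mid_def)
    have half: "mid - lo \<le> 2 ^ (d - 1)" "hi - mid \<le> 2 ^ (d - 1)" "0 < d" if "hi - lo \<le> 2 ^ d" for d
    proof -
      show "0 < d" using that False by (cases d) auto
      then have "(2::nat) ^ d = 2 * 2 ^ (d - 1)" by (cases d) auto
      then show "mid - lo \<le> 2 ^ (d - 1)" "hi - mid \<le> 2 ^ (d - 1)"
        using that False unfolding mid_def by linarith+
    qed
    obtain a1 c1 A1 t1 where r1: "par_min_max body lo mid A = ((a1, c1), A1, t1)"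
      by (metis surj_pair)
    obtain a2 c2 A2 t2 where r2: "par_min_max body mid hi A1 = ((a2, c2), A2, t2)"
      by (metis surj_pair)
    have eq: "a = min a1 a2" "c = max c1 c2" "A' = A2"
      "t = map Step [Local] @ Fork t1 t2 # map Step [Local]"
      using less.prems(6) False r1 r2
      by (auto simp: par_min_max.simps[of body lo hi] bind_prog_def compute_def fork_def
          mid_def[symmetric])
    have IH1: "(\<exists>i\<in>{lo..<mid}. Q i a1) \<and> (\<exists>i\<in>{lo..<mid}. Q i c1) \<and> a1 \<le> c1 \<and> length A1 = N \<and>
      (\<forall>x. x \<notin> \<Union> (R ` {lo..<mid}) \<longrightarrow> A1 ! x = A ! x) \<and>
      comp_work t1 + 3 \<le> (W + 4) * (mid - lo) \<and>
      (\<forall>d. mid - lo \<le> 2 ^ d \<longrightarrow> comp_span t1 \<le> W + 1 + 3 * d) \<and>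
      comp_cost GL cap b t1 (D * (mid - lo))"
      by (rule less.hyps) (use mid less.prems r1 in auto)
    have A1: "A1 ! x = A0 ! x" if i: "mid \<le> i" "i < hi" and x: "x \<in> R i" for i x
    proof -
      have "x \<notin> R j" if "j \<in> {lo..<mid}" for j
        using disj[of i j] i x that less.prems(1,3) mid by auto
      then have "A1 ! x = A ! x" using IH1 by blast
      then show ?thesis using less.prems(5)[of i x] i x mid by simp
    qed
    have IH2: "(\<exists>i\<in>{mid..<hi}. Q i a2) \<and> (\<exists>i\<in>{mid..<hi}. Q i c2) \<and> a2 \<le> c2 \<and> length A2 = N \<and>
      (\<forall>x. x \<notin> \<Union> (R ` {mid..<hi}) \<longrightarrow> A2 ! x = A1 ! x) \<and>
      comp_work t2 + 3 \<le> (W + 4) * (hi - mid) \<and>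
      (\<forall>d. hi - mid \<le> 2 ^ d \<longrightarrow> comp_span t2 \<le> W + 1 + 3 * d) \<and>
      comp_cost GL cap b t2 (D * (hi - mid))"
      by (rule less.hyps) (use mid less.prems r2 A1 IH1 in auto)
    have split: "hi - lo = (mid - lo) + (hi - mid)" using mid by simp
    have ivl: "{lo..<hi} = {lo..<mid} \<union> {mid..<hi}" using mid by auto
    have "\<exists>i\<in>{lo..<hi}. Q i a" "\<exists>i\<in>{lo..<hi}. Q i c"
      using IH1 IH2 unfolding eq ivl min_def max_def by (auto split: if_splits)
    moreover have "a \<le> c" using IH1 IH2 unfolding eq by linarith
    moreover have "\<forall>x. x \<notin> \<Union> (R ` {lo..<hi}) \<longrightarrow> A' ! x = A ! x"
      using IH1 IH2 unfolding eq ivl by simp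
    moreover have "comp_work t + 3 \<le> (W + 4) * (hi - lo)"
      using IH1 IH2 unfolding split by (simp add: eq distrib_left)
    moreover have "comp_span t \<le> W + 1 + 3 * d" if "hi - lo \<le> 2 ^ d" for d
    proof -
      have "comp_span t1 \<le> W + 1 + 3 * (d - 1)" "comp_span t2 \<le> W + 1 + 3 * (d - 1)"
        using IH1 IH2 half[OF that] by blast+
      then show ?thesis using half(3)[OF that] by (simp add: eq)
    qed
    moreover have "comp_cost GL cap b t (0 + (D * (mid - lo) + D * (hi - mid) + (0 + 0)))"
      unfolding eq
      by (intro comp_cost.steps comp_cost.fork local
          comp_cost.steps[OF local comp_cost.nil, unfolded append_Nil2])
        (use IH1 IH2 in blast)+
    then have "comp_cost GL cap b t (D * (hi - lo))"
      unfolding split distrib_left by simp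
    ultimately show ?thesis using IH2 eq by blast
  qed
qed

text \<open>The line of \<open>Glob j\<close> is named \<open>Glob (j div b)\<close> and
  \<open>j div b \<le> j\<close>, so pinning the names below \<open>Q\<close> covers the accessed
  part of \<open>X\<close> whatever \<open>b\<close> is. Only lines in \<open>E\<close> can
  miss.\<close>

lemma serve_cost_strand:
  assumes "accessed ops \<subseteq> Glob ` {..<s} \<union> Elem ` R" "line_of b ` Elem ` R \<subseteq> E"
    and "s \<le> Q" "finite E" "Q + card E \<le> cap" "card E \<le> k"
  shows "serve_cost (Glob ` {..<Q}) cap (lines b ops) k"
proof (rule serve_cost_mono[OF serve_cost_lines])
  have "line_of b ` Glob ` {..<s} \<subseteq> Glob ` {..<Q}"
  proof -
    have "j div b < Q" if "j < s" for j using that assms(3) div_le_dividend[of j b] by linarith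
    then show ?thesis by auto
  qed
  then show "set (lines b ops) \<subseteq> Glob ` {..<Q} \<union> E"
    using order.trans[OF image_mono[OF assms(1), of "line_of b"]] Un_mono[OF _ assms(2)]
    unfolding set_lines image_Un by simp
  have "card (Glob ` {..<Q}) \<le> Q" using card_image_le[of "{..<Q}" Glob] by simp
  then show "card (Glob ` {..<Q}) + card E \<le> cap" using assms(5) by linarith
qed (use assms in auto)

lemma stride_preds_cong:
  assumes "\<And>x. x \<in> stride_region b g s X base m i \<Longrightarrow> B ! x = A ! x"
  shows "stride_preds P b g s X base m i B = stride_preds P b g s X base m i A"
  unfolding stride_preds_def
  by (rule arg_cong[of _ _ card], rule Collect_cong) (use assms in \<open>auto simp: stride_region_def\<close>)

text \<open>Minimum and maximum are attained by some strides, so their distance is controlled by the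
  difference of two predecessor counts, scaled by \<open>g\<close>. The capacity leaves room for the
  pinned lines and two memory lines per block of a stride.\<close>

lemma partial_partition_spec:
  assumes b: "0 < b" and g: "0 < g" and s: "0 < s"
    and m: "(s - 1) * g * b < m" "m \<le> g * b * s" and A: "base + m \<le> length A"
    and cap: "s \<le> Q" "Q + 2 * s \<le> cap"
    and res: "partial_partition P b g s X base m A = ((a, c), A', t)"
  shows "a \<le> c" "c \<le> m" "length A' = length A"
    "\<exists>i\<in>{1..g}. \<exists>j\<in>{1..g}. c + stride_preds P b g s X base m j A * g
      \<le> a + stride_preds P b g s X base m i A * g + 3 * (g * b)"
    "comp_work t \<le> (10 * (s * b) + 8) * g"
    "\<And>d. g \<le> 2 ^ d \<Longrightarrow> comp_span t \<le> 10 * (s * b) + 5 + 3 * d"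
    "comp_cost (Glob ` {..<Q}) cap b t (line_factor b base * s * g)"
proof -
  let ?K = "\<lambda>i. stride_preds P b g s X base m i A"
  \<comment> \<open>Rounding the count down to a multiple of \<open>b\<close> is harmless in the
    upper bound and costs a second \<open>g * b\<close> in the lower one. Applied to the maximum and
    the minimum, the slacks 1 and 2 add up to the factor 3 of the claim.\<close>
  define V where "V i v \<longleftrightarrow> v \<le> m \<and> v \<le> ?K i * g + g * b \<and> ?K i * g \<le> v + 2 * (g * b)" for i v
  have "(\<exists>i\<in>{1..<g+1}. V i a) \<and> (\<exists>i\<in>{1..<g+1}. V i c) \<and> a \<le> c \<and> length A' = length A \<and>
    (\<forall>x. x \<notin> \<Union> (stride_region b g s X base m ` {1..<g+1}) \<longrightarrow> A' ! x = A ! x) \<and>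
    comp_work t + 3 \<le> ((10 * (s * b) + 4) + 4) * (g + 1 - 1) \<and>
    (\<forall>d. g + 1 - 1 \<le> 2 ^ d \<longrightarrow> comp_span t \<le> (10 * (s * b) + 4) + 1 + 3 * d) \<and>
    comp_cost (Glob ` {..<Q}) cap b t (line_factor b base * s * (g + 1 - 1))"
  proof (rule par_min_max_spec)
    show "par_min_max (partition_stride P b g s X base m) 1 (g + 1) A = ((a, c), A', t)"
      using res by (simp add: partial_partition_def)
    show "stride_region b g s X base m i \<inter> stride_region b g s X base m j = {}"
      if "1 \<le> i" "i < g + 1" "1 \<le> j" "j < g + 1" "i \<noteq> j" for i j
      using stride_regions_disjoint[OF b g] that by simp
    fix i B v B' t1
    assume i: "1 \<le> i" "i < g + 1" and B: "length B = length A"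
      "\<forall>x\<in>stride_region b g s X base m i. B ! x = A ! x"
      and r: "partition_stride P b g s X base m i B = (v, B', t1)"
    have "base + m \<le> length B" using A B by simp
    note spec = partition_stride_spec[OF b g s m this r]
    have K: "stride_preds P b g s X base m i B = ?K i"
      using B by (intro stride_preds_cong) auto
    then obtain ops where spec': "v \<le> m" "v \<le> ?K i div b * g * b + g * b"
      "?K i div b * g * b \<le> v + g * b" "length B' = length B"
      "\<forall>x. x \<notin> stride_region b g s X base m i \<longrightarrow> B' ! x = B ! x"
      "t1 = map Step ops" "length ops \<le> 10 * (s * b) + 4"
      "accessed ops \<subseteq> Glob ` {..<s} \<union> Elem ` stride_region b g s X base m i"
      using spec by auto
    obtain E where E: "line_of b ` Elem ` stride_region b g s X base m i \<subseteq> E"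
      "finite E" "card E \<le> line_factor b base * s"
      using stride_region_lines[OF b g s m(1)] .
    have "line_factor b base * s \<le> 2 * s" by (simp add: line_factor_def)
    then have "Q + card E \<le> cap" using E(3) cap(2) by linarith
    then have sc: "serve_cost (Glob ` {..<Q}) cap (lines b ops) (line_factor b base * s)"
      using E cap by (intro serve_cost_strand[OF spec'(8)]) auto
    have "?K i = ?K i div b * b + ?K i mod b" "?K i mod b < b" using b by auto
    then have "?K i div b * b \<le> ?K i" "?K i \<le> ?K i div b * b + b" by linarith+
    then have "?K i div b * b * g \<le> ?K i * g" "?K i * g \<le> (?K i div b * b + b) * g"
      by (auto intro: mult_le_mono1)
    moreover have "?K i div b * b * g = ?K i div b * g * b" "b * g = g * b" by simp_all
    ultimately have "V i v"
      using spec'(1-3) unfolding V_def add_mult_distrib by (intro conjI; linarith)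
    then show "V i v \<and> length B' = length A \<and>
        (\<forall>x. x \<notin> stride_region b g s X base m i \<longrightarrow> B' ! x = B ! x) \<and>
        (\<exists>ops. t1 = map Step ops \<and> length ops \<le> 10 * (s * b) + 4 \<and>
          serve_cost (Glob ` {..<Q}) cap (lines b ops) (line_factor b base * s))"
      using spec' sc B by auto
  qed (use g in auto)
  moreover have G: "g + 1 - 1 = g" "{1..<g + 1} = {1..g}" by auto
  ultimately have 1: "\<exists>j\<in>{1..g}. V j a" "\<exists>i\<in>{1..g}. V i c" and 2: "a \<le> c" "length A' = length A"
    "comp_work t + 3 \<le> (10 * (s * b) + 4 + 4) * g"
    "\<forall>d. g \<le> 2 ^ d \<longrightarrow> comp_span t \<le> 10 * (s * b) + 4 + 1 + 3 * d"
    "comp_cost (Glob ` {..<Q}) cap b t (line_factor b base * s * g)"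
    unfolding G by blast+
  from 1 obtain i j where ij: "i \<in> {1..g}" "V i c" "j \<in> {1..g}" "V j a" by blast
  then have "c + ?K j * g \<le> a + ?K i * g + 3 * (g * b)" by (simp add: V_def)
  with ij show "\<exists>i\<in>{1..g}. \<exists>j\<in>{1..g}. c + ?K j * g \<le> a + ?K i * g + 3 * (g * b)" by blast
  show "c \<le> m" using ij by (simp add: V_def)
  show "a \<le> c" "length A' = length A" "comp_work t \<le> (10 * (s * b) + 8) * g"
    "\<And>d. g \<le> 2 ^ d \<Longrightarrow> comp_span t \<le> 10 * (s * b) + 5 + 3 * d"
    "comp_cost (Glob ` {..<Q}) cap b t (line_factor b base * s * g)"
    using 2 by (auto simp: add.commute)
qed

section \<open>Predecessor counts as sums of independent variables, and their concentration\<close>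

definition line_preds :: "('e \<Rightarrow> bool) \<Rightarrow> nat \<Rightarrow> nat \<Rightarrow> nat \<Rightarrow> nat \<Rightarrow> 'e list \<Rightarrow> nat \<Rightarrow> nat \<Rightarrow> nat" where
  "line_preds P b g base m A j r =
    card {q\<in>{..<b}. (r + j * g) * b + q < m \<and> P (A ! (base + ((r + j * g) * b + q)))}"

lemma line_preds_le: "line_preds P b g base m A j r \<le> b"
proof -
  have "line_preds P b g base m A j r \<le> card {..<b}"
    unfolding line_preds_def by (intro card_mono) auto
  then show ?thesis by simp
qed

text \<open>Splitting an index of the stride into block and offset turns the count into a sum whose
  j-th term depends on \<open>X j\<close> alone, as Hoeffding's inequality requires.\<close>

lemma stride_preds_eq_sum:
  assumes b: "0 < b" and g: "0 < g" and s: "0 < s" and m: "(s - 1) * g * b < m"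
  shows "stride_preds P b g s X base m i A =
    (\<Sum>j<s. line_preds P b g base m A j ((X j + i) mod g))"
proof -
  let ?T = "\<lambda>j. {q\<in>{..<b}. stride_line g X i j * b + q < m \<and>
    P (A ! (base + (stride_line g X i j * b + q)))}"
  let ?K = "{k\<in>{0..<stride_len b g s X m i}. P (A ! (base + stride_idx b g X i k))}"
  have iff: "k \<in> ?K \<longleftrightarrow> k div b < s \<and> k mod b \<in> ?T (k div b)" for k
    using less_stride_len_iff[OF b g s m, of k X i] b by (auto simp: stride_idx_def)
  have "bij_betw (\<lambda>k. (k div b, k mod b)) ?K (Sigma {..<s} ?T)"
  proof (rule bij_betw_byWitness[where f' = "\<lambda>(j, q). j * b + q"])
    show "\<forall>k\<in>?K. (\<lambda>(j, q). j * b + q) (k div b, k mod b) = k" by simp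
    show "\<forall>a'\<in>Sigma {..<s} ?T. (\<lambda>k. (k div b, k mod b)) ((\<lambda>(j, q). j * b + q) a') = a'" by auto
    show "(\<lambda>k. (k div b, k mod b)) ` ?K \<subseteq> Sigma {..<s} ?T" using iff by blast
    show "(\<lambda>(j, q). j * b + q) ` Sigma {..<s} ?T \<subseteq> ?K"
    proof
      fix k assume "k \<in> (\<lambda>(j, q). j * b + q) ` Sigma {..<s} ?T"
      then obtain j q where *: "k = j * b + q" "j < s" "q \<in> ?T j" by auto
      then have "k div b = j" "k mod b = q" by auto
      then show "k \<in> ?K" using * by (subst iff) simp
    qed
  qed
  then have "card ?K = card (Sigma {..<s} ?T)" by (rule bij_betw_same_card)
  also have "\<dots> = (\<Sum>j<s. card (?T j))" by (rule card_SigmaI) auto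
  finally show ?thesis
    unfolding stride_preds_def line_preds_def stride_line_def .
qed

lemma bij_betw_add_mod: "0 < g \<Longrightarrow> bij_betw (\<lambda>x. (x + i) mod g) {1..g} {..<g::nat}"
proof -
  assume g: "0 < g"
  have inj: "inj_on (\<lambda>x. (x + i) mod g) {1..g}"
  proof (rule inj_onI)
    fix x y assume "x \<in> {1..g}" "y \<in> {1..g}" "(x + i) mod g = (y + i) mod g"
    then show "x = y" using add_mod_inj[of i x g y] by (simp add: add.commute[of i])
  qed
  moreover have "(\<lambda>x. (x + i) mod g) ` {1..g} = {..<g}"
  proof (rule card_subset_eq)
    show "card ((\<lambda>x. (x + i) mod g) ` {1..g}) = card {..<g}"
      using card_image[OF inj] by simp
  qed (use g in auto)
  ultimately show ?thesis by (simp add: bij_betw_def)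
qed

text \<open>The map \<open>x \<mapsto> (x + i) mod g\<close> carries the uniform distribution on
  \<open>{1..g}\<close> to the one on the residues, so the mean of the j-th term is the average of
  \<open>h j\<close> whatever \<open>i\<close> is. This is why one \<open>\<mu>\<close> serves all
  strides. The strides share \<open>X\<close> and are dependent, which the union bound
  tolerates.\<close>

lemma draw_X_concentration:
  fixes h :: "nat \<Rightarrow> nat \<Rightarrow> real"
  assumes g: "0 < g" and s: "0 < s" and b: "0 < b"
    and h: "\<And>j r. 0 \<le> h j r" "\<And>j r. h j r \<le> real b" and d: "0 \<le> d"
  obtains \<mu> where "measure_pmf.prob (draw_X g s)
      {X. \<exists>i\<in>{1..g}. \<bar>(\<Sum>j<s. h j ((X j + i) mod g)) - \<mu>\<bar> \<ge> d * (real s * real b)}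
    \<le> 2 * real g * exp (- 2 * d\<^sup>2 * real s)"
proof -
  define \<mu> where "\<mu> = (\<Sum>j<s. (\<Sum>r<g. h j r) / real g)"
  define M where "M = draw_X g s"
  let ?bad = "\<lambda>i. {X. \<bar>(\<Sum>j<s. h j ((X j + i) mod g)) - \<mu>\<bar> \<ge> d * (real s * real b)}"
  have single: "measure_pmf.prob M (?bad i) \<le> 2 * exp (- 2 * d\<^sup>2 * real s)" for i
  proof -
    have E: "measure_pmf.expectation M (\<lambda>X. h j ((X j + i) mod g)) = (\<Sum>r<g. h j r) / real g"
      if "j < s" for j
    proof -
      have "map_pmf (\<lambda>X. X j) M = pmf_of_set {1..g}"
        unfolding M_def draw_X_def using that by (subst Pi_pmf_component) auto
      moreover have "measure_pmf.expectation M (\<lambda>X. h j ((X j + i) mod g)) =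
          measure_pmf.expectation (map_pmf (\<lambda>X. X j) M) (\<lambda>x. h j ((x + i) mod g))"
        by simp
      ultimately have "measure_pmf.expectation M (\<lambda>X. h j ((X j + i) mod g)) =
          measure_pmf.expectation (pmf_of_set {1..g}) (\<lambda>x. h j ((x + i) mod g))"
        by (simp only:)
      also have "\<dots> = (\<Sum>x\<in>{1..g}. h j ((x + i) mod g)) / real g"
        using g by (subst integral_pmf_of_set) auto
      also have "(\<Sum>x\<in>{1..g}. h j ((x + i) mod g)) = (\<Sum>r<g. h j r)"
        by (rule sum.reindex_bij_betw[OF bij_betw_add_mod[OF g]])
      finally show ?thesis .
    qed
    interpret H: Hoeffding_ineq "measure_pmf M" "{..<s}" "\<lambda>j X. h j ((X j + i) mod g)"
      "\<lambda>_. 0" "\<lambda>_. real b" \<mu>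
    proof unfold_locales
      show "prob_space.indep_vars M (\<lambda>_. borel) (\<lambda>j X. h j ((X j + i) mod g)) {..<s}"
        unfolding M_def draw_X_def
        by (rule prob_space.indep_vars_compose2[OF measure_pmf.prob_space_axioms indep_vars_Pi_pmf]) auto
      show "\<mu> \<equiv> (\<Sum>j<s. measure_pmf.expectation M (\<lambda>X. h j ((X j + i) mod g)))"
        using E by (simp add: \<mu>_def)
    qed (use h in auto)
    have "measure_pmf.prob M {X \<in> space (measure_pmf M).
          \<bar>(\<Sum>j<s. h j ((X j + i) mod g)) - \<mu>\<bar> \<ge> d * (real s * real b)}
        \<le> 2 * exp (- 2 * (d * (real s * real b))\<^sup>2 / (\<Sum>j<s. (real b - 0)\<^sup>2))"
      by (rule H.Hoeffding_ineq_abs_ge) (use d s b in auto)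
    moreover have "- 2 * (d * (real s * real b))\<^sup>2 / (\<Sum>j<s. (real b - 0)\<^sup>2) = - 2 * d\<^sup>2 * real s"
      using s b by (simp add: field_simps power2_eq_square)
    ultimately show ?thesis by simp
  qed
  have "{X. \<exists>i\<in>{1..g}. \<bar>(\<Sum>j<s. h j ((X j + i) mod g)) - \<mu>\<bar> \<ge> d * (real s * real b)} =
      (\<Union>i\<in>{1..g}. ?bad i)" by auto
  also have "measure_pmf.prob M \<dots> \<le> (\<Sum>i\<in>{1..g}. measure_pmf.prob M (?bad i))"
    by (rule measure_pmf.finite_measure_subadditive_finite) auto
  also have "\<dots> \<le> (\<Sum>i\<in>{1..g}. 2 * exp (- 2 * d\<^sup>2 * real s))"
    by (intro sum_mono single)
  finally show ?thesis using that by (simp add: M_def mult_ac)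
qed

section \<open>Sizes of the numbers of groups and blocks\<close>

lemma num_blocks_le:
  assumes "0 < b" "1 \<le> num_groups b \<epsilon> \<delta> m"
  shows "num_blocks b \<epsilon> \<delta> m \<le> 2 * min_blocks \<epsilon> \<delta> m"
proof -
  define g s0 where "g = num_groups b \<epsilon> \<delta> m" and "s0 = min_blocks \<epsilon> \<delta> m"
  have s0: "0 < s0" by (simp add: s0_def min_blocks_def)
  \<comment> \<open>\<open>g\<close> is a quotient rounded down; once it is at least 1, the rounding
    loses at most a factor 2.\<close>
  have "m < (g + 1) * (b * s0)"
    using dividend_less_div_times[of "b * s0" m] assms s0
    by (simp add: g_def s0_def num_groups_def algebra_simps)
  also have "\<dots> \<le> (2 * g) * (b * s0)"
    using assms(2) by (intro mult_le_mono1) (simp add: g_def)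
  finally have "real m \<le> real (2 * s0) * real (g * b)"
    by (simp add: mult_ac flip: of_nat_mult)
  then have "real m / real (g * b) \<le> real (2 * s0)"
    using assms by (simp add: divide_le_eq g_def)
  then have "\<lceil>real m / real (g * b)\<rceil> \<le> int (2 * s0)" by (simp add: ceiling_le_iff)
  then show ?thesis unfolding num_blocks_def g_def[symmetric] s0_def[symmetric] by linarith
qed

text \<open>As \<open>2 * m / \<epsilon>\<close> is at least 4, its logarithm is at least 1 and the
  number of blocks at least \<open>1 / \<delta>\<^sup>2\<close>. An error of one group, from padding
  or from rounding positions, is therefore a \<open>\<delta>\<^sup>2\<close> fraction of
  \<open>m\<close>.\<close>

lemma groups_times_line_le:
  assumes "0 < b" "0 < \<delta>" "0 < \<epsilon>" "\<epsilon> \<le> 1 / 2" "1 \<le> m"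
  shows "real (num_groups b \<epsilon> \<delta> m * b) \<le> \<delta>\<^sup>2 * real m"
proof -
  have "exp 1 \<le> (4 :: real)" using exp_le by linarith
  also have "4 \<le> 2 * real m / \<epsilon>"
    using assms by (simp add: field_simps)
  finally have "1 \<le> ln (2 * real m / \<epsilon>)"
    using assms by (subst ln_ge_iff) auto
  then have "1 / \<delta>\<^sup>2 \<le> ln (2 * real m / \<epsilon>) / \<delta>\<^sup>2"
    by (intro divide_right_mono) auto
  also have "\<dots> \<le> real (min_blocks \<epsilon> \<delta> m)" unfolding min_blocks_def by linarith
  finally have s0: "1 \<le> \<delta>\<^sup>2 * real (min_blocks \<epsilon> \<delta> m)" using assms by (simp add: field_simps)
  have "num_groups b \<epsilon> \<delta> m * (b * min_blocks \<epsilon> \<delta> m) \<le> m"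
    unfolding num_groups_def by (rule div_times_less_eq_dividend)
  then have *: "real (num_groups b \<epsilon> \<delta> m * b) * real (min_blocks \<epsilon> \<delta> m) \<le> real m"
    by (simp add: mult_ac flip: of_nat_mult)
  have "real (num_groups b \<epsilon> \<delta> m * b) \<le> real (num_groups b \<epsilon> \<delta> m * b) * (\<delta>\<^sup>2 * real (min_blocks \<epsilon> \<delta> m))"
    using mult_left_mono[OF s0, of "real (num_groups b \<epsilon> \<delta> m * b)"] by simp
  also have "\<dots> = \<delta>\<^sup>2 * (real (num_groups b \<epsilon> \<delta> m * b) * real (min_blocks \<epsilon> \<delta> m))" by simp
  also have "\<dots> \<le> \<delta>\<^sup>2 * real m" by (intro mult_left_mono *) auto
  finally show ?thesis .
qed

lemma draw_trace_eq:
  "draw_trace s = map Step (concat (map (\<lambda>j. [Local, Access (Glob j)]) [0..<s]))"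
  by (simp add: draw_trace_def map_concat comp_def)

lemma length_draw_trace: "length (draw_trace s) = 2 * s"
  by (induction s) (auto simp: draw_trace_def)

lemma comp_draw_trace [simp]: "comp_work (draw_trace s) = 2 * s" "comp_span (draw_trace s) = 2 * s"
  using length_draw_trace[of s] unfolding draw_trace_eq by simp_all

lemma comp_cost_strand:
  assumes "serve_cost GL cap (lines b ops) k"
  shows "comp_cost GL cap b (map Step ops) k"
  using comp_cost.steps[OF assms comp_cost.nil] by simp

lemma comp_cost_draw_trace:
  assumes "s \<le> Q" "Q \<le> cap"
  shows "comp_cost (Glob ` {..<Q}) cap b (Step Local # draw_trace s) 0"
proof -
  have "accessed (concat (map (\<lambda>j. [Local, Access (Glob j)]) [0..<s])) \<subseteq> Glob ` {..<s} \<union> Elem ` {}"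
    by (induction s) auto
  then have "serve_cost (Glob ` {..<Q}) cap
      (lines b (Local # concat (map (\<lambda>j. [Local, Access (Glob j)]) [0..<s]))) 0"
    using assms by (intro serve_cost_strand[where E = "{}"]) auto
  from comp_cost_strand[OF this] show ?thesis by (simp add: draw_trace_eq)
qed

text \<open>The 7 is 4 + 3. Two counts differ by at most \<open>2 * \<delta> * s * b\<close>, which
  times \<open>g\<close> is at most \<open>4 * \<delta> * m\<close> because the padded length is at
  most \<open>2 * m\<close>; three groups of rounding add at most
  \<open>3 * \<delta>\<^sup>2 * m\<close>. The 31 is 1 for the parameters, 2 for drawing
  \<open>X\<close>, 20 for the serial partitions and 8 for the loop.\<close>

lemma partial_partition_level:
  fixes A :: "'e list" and \<epsilon> \<delta> :: real and b m Q cap base :: nat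
  defines "g \<equiv> num_groups b \<epsilon> \<delta> m" and "s \<equiv> num_blocks b \<epsilon> \<delta> m"
  assumes b: "0 < b" and eps: "0 < \<epsilon>" "\<epsilon> \<le> 1 / 2" and del: "0 < \<delta>" "\<delta> < 1"
    and g2: "2 \<le> g" and A: "base + m \<le> length A"
    and Q: "2 * min_blocks \<epsilon> \<delta> m \<le> Q" "3 * Q \<le> cap"
  obtains G where "measure_pmf.prob (draw_X g s) G \<ge> 1 - \<epsilon>\<^sup>2"
    and "\<And>X a c A' t. X \<in> G \<Longrightarrow> partial_partition P b g s X base m A = ((a, c), A', t) \<Longrightarrow>
      a \<le> c \<and> c \<le> m \<and> real (c - a) \<le> 7 * \<delta> * real m \<and> length A' = length A \<and>
      comp_work (Step Local # draw_trace s @ t) \<le> 31 * m \<and>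
      (\<forall>d. m \<le> 2 ^ d \<longrightarrow>
        comp_span (Step Local # draw_trace s @ t) \<le> 24 * (min_blocks \<epsilon> \<delta> m * b) + 6 + 3 * d) \<and>
      comp_cost (Glob ` {..<Q}) cap b (Step Local # draw_trace s @ t) (line_factor b base * s * g)"
proof -
  have g: "0 < g" "1 \<le> g" using g2 by auto
  note step = step_params[OF b eps(1) del(1) g(2)[unfolded g_def], folded g_def s_def]
  have s2: "s \<le> 2 * min_blocks \<epsilon> \<delta> m"
    using num_blocks_le[OF b g(2)[unfolded g_def]] by (simp add: s_def)
  have "g * (b * min_blocks \<epsilon> \<delta> m) \<le> m"
    unfolding g_def num_groups_def by (rule div_times_less_eq_dividend)
  moreover have "g * b * 1 \<le> g * b * min_blocks \<epsilon> \<delta> m"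
    by (intro mult_le_mono2) (simp add: min_blocks_def)
  ultimately have gb: "g * b \<le> m" unfolding mult.assoc[of g b] mult_1_right by (rule order.trans[rotated])
  have "0 < g * b" using g b by simp
  then have m0: "1 \<le> m" using gb by linarith
  have s: "0 < s" using step(1) m0 by (cases s) auto
  have "(s - 1) * g * b + g * b = g * b * s" using s by (cases s) auto
  then have sm: "(s - 1) * g * b < m" using step(2) by linarith
  have gbs: "g * b * s \<le> 2 * m" using step(2) gb by linarith
  have gb_le: "real (g * b) \<le> \<delta>\<^sup>2 * real m"
    unfolding g_def by (rule groups_times_line_le[OF b del(1) eps m0])
  define h where "h j r = real (line_preds P b g base m A j r)" for j r
  have hb: "\<And>j r. 0 \<le> h j r" "\<And>j r. h j r \<le> real b"
    by (simp_all add: h_def line_preds_le)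
  obtain \<mu> where \<mu>: "measure_pmf.prob (draw_X g s)
      {X. \<exists>i\<in>{1..g}. \<bar>(\<Sum>j<s. h j ((X j + i) mod g)) - \<mu>\<bar> \<ge> \<delta> * (real s * real b)}
    \<le> 2 * real g * exp (- 2 * \<delta>\<^sup>2 * real s)"
    by (rule draw_X_concentration[OF g(1) s b hb less_imp_le[OF del(1)]])
  define G where "G = {X. \<forall>i\<in>{1..g}. \<bar>(\<Sum>j<s. h j ((X j + i) mod g)) - \<mu>\<bar> < \<delta> * (real s * real b)}"
  \<comment> \<open>The choice of \<open>s\<close> gives
    \<open>\<delta>\<^sup>2 * s \<ge> ln (w / \<epsilon>)\<close>, and Hoeffding's exponent contains
    twice this, hence \<open>(\<epsilon> / w)\<^sup>2\<close>. With \<open>g \<ge> 2\<close> the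
    factor \<open>2 * g\<close> of the union bound is at most \<open>g * g \<le> w * w\<close>, so
    it cancels completely.\<close>
  have "2 * real g * exp (- 2 * \<delta>\<^sup>2 * real s) \<le> \<epsilon>\<^sup>2"
  proof -
    define w where "w = real (g * b * s)"
    have "g * 1 \<le> g * (b * s)" using b s by (intro mult_le_mono2) (simp add: Suc_le_eq)
    then have "g \<le> g * b * s" by (metis mult.assoc mult_1_right)
    then have w: "real g \<le> w" "0 < w"
      using g unfolding w_def of_nat_le_iff of_nat_0_less_iff by linarith+
    have "ln (w / \<epsilon>) \<le> \<delta>\<^sup>2 * real s"
      using step(3) del unfolding w_def by (simp add: field_simps)
    then have "exp (- 2 * \<delta>\<^sup>2 * real s) \<le> exp (- 2 * ln (w / \<epsilon>))" by simp
    also have "\<dots> = inverse (exp (ln (w / \<epsilon>)) ^ 2)"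
      by (simp add: exp_minus flip: exp_of_nat_mult)
    also have "exp (ln (w / \<epsilon>)) = w / \<epsilon>" using w eps by simp
    finally have "exp (- 2 * \<delta>\<^sup>2 * real s) \<le> \<epsilon>\<^sup>2 / w\<^sup>2" by (simp add: power_divide)
    then have "2 * real g * exp (- 2 * \<delta>\<^sup>2 * real s) \<le> 2 * real g * (\<epsilon>\<^sup>2 / w\<^sup>2)"
      by (intro mult_left_mono) auto
    also have "\<dots> \<le> w\<^sup>2 * (\<epsilon>\<^sup>2 / w\<^sup>2)"
    proof (intro mult_right_mono)
      have "2 * real g \<le> real g * real g" using g2 by (intro mult_right_mono) auto
      also have "\<dots> \<le> w * w" using w by (intro mult_mono) auto
      finally show "2 * real g \<le> w\<^sup>2" by (simp add: power2_eq_square)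
    qed auto
    also have "\<dots> = \<epsilon>\<^sup>2" using w by simp
    finally show ?thesis .
  qed
  moreover have "measure_pmf.prob (draw_X g s) G = 1 - measure_pmf.prob (draw_X g s) (- G)"
    using measure_pmf.prob_compl[of "- G" "draw_X g s"] by (simp add: Compl_eq_Diff_UNIV[symmetric])
  moreover have "- G = {X. \<exists>i\<in>{1..g}. \<bar>(\<Sum>j<s. h j ((X j + i) mod g)) - \<mu>\<bar> \<ge> \<delta> * (real s * real b)}"
    by (auto simp: G_def not_less)
  ultimately have prob: "measure_pmf.prob (draw_X g s) G \<ge> 1 - \<epsilon>\<^sup>2" using \<mu> by simp
  show ?thesis
  proof (rule that[OF prob])
    fix X a c A' t
    assume X: "X \<in> G" and r: "partial_partition P b g s X base m A = ((a, c), A', t)"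
    have cap: "s \<le> Q" "Q + 2 * s \<le> cap" using Q s2 by linarith+
    note spec = partial_partition_spec[OF b g(1) s sm step(1) A cap r]
    let ?K = "\<lambda>i. stride_preds P b g s X base m i A"
    from spec(4) obtain i j where ij: "i \<in> {1..g}" "j \<in> {1..g}"
      "c + ?K j * g \<le> a + ?K i * g + 3 * (g * b)" by blast
    have K: "real (?K i) = (\<Sum>j<s. h j ((X j + i) mod g))" for i
      by (simp add: stride_preds_eq_sum[OF b g(1) s sm] h_def)
    have "\<bar>real (?K i) - \<mu>\<bar> < \<delta> * (real s * real b)" "\<bar>real (?K j) - \<mu>\<bar> < \<delta> * (real s * real b)"
      using X ij unfolding G_def K by auto
    then have "real (?K i) - real (?K j) \<le> 2 * \<delta> * (real s * real b)" by linarith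
    then have "(real (?K i) - real (?K j)) * real g \<le> 2 * \<delta> * (real s * real b) * real g"
      by (intro mult_right_mono) auto
    also have "\<dots> = 2 * \<delta> * real (g * b * s)" by simp
    also have "\<dots> \<le> 2 * \<delta> * real (2 * m)"
      using gbs del by (intro mult_left_mono) (simp_all only: of_nat_le_iff)
    finally have 1: "(real (?K i) - real (?K j)) * real g \<le> 4 * \<delta> * real m" by simp
    have "real (c + ?K j * g) \<le> real (a + ?K i * g + 3 * (g * b))" using ij(3) by (rule of_nat_mono)
    then have "real (c - a) \<le> (real (?K i) - real (?K j)) * real g + 3 * real (g * b)"
      using spec(1) by (simp add: algebra_simps)
    moreover have "\<delta>\<^sup>2 * real m \<le> \<delta> * real m"
      using del by (intro mult_right_mono) (auto simp: power2_eq_square mult_left_le)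
    ultimately have ca: "real (c - a) \<le> 7 * \<delta> * real m" using 1 gb_le by simp
    have "2 * s \<le> g * b * s" using g2 b by (intro mult_le_mono1) (metis mult_le_mono nat_mult_1_right Suc_leI One_nat_def)
    then have sm2: "s \<le> m" using gbs by linarith
    have "g * 1 \<le> g * b" using b by (intro mult_le_mono2) simp
    then have gm: "g \<le> m" using gb by linarith
    have "comp_work t \<le> 10 * (g * b * s) + 8 * g"
      using spec(5) by (simp add: algebra_simps)
    then have work: "comp_work (Step Local # draw_trace s @ t) \<le> 31 * m"
      using gbs sm2 gm m0 by simp
    have "comp_span (Step Local # draw_trace s @ t) \<le> 24 * (min_blocks \<epsilon> \<delta> m * b) + 6 + 3 * d"
      if "m \<le> 2 ^ d" for d
    proof -
      have "comp_span t \<le> 10 * (s * b) + 5 + 3 * d" using spec(6)[of d] that gm by linarith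
      moreover have "s * 1 \<le> s * b" using b by (intro mult_le_mono2) simp
      moreover have "s * b \<le> 2 * (min_blocks \<epsilon> \<delta> m * b)"
        using mult_le_mono1[OF s2, of b] by (simp only: mult.assoc)
      moreover have "comp_span (Step Local # draw_trace s @ t) = 1 + 2 * s + comp_span t" by simp
      ultimately show ?thesis by linarith
    qed
    moreover have "comp_cost (Glob ` {..<Q}) cap b ((Step Local # draw_trace s) @ t) (0 + line_factor b base * s * g)"
      using cap by (intro comp_cost_append comp_cost_draw_trace spec(7)) auto
    ultimately show "a \<le> c \<and> c \<le> m \<and> real (c - a) \<le> 7 * \<delta> * real m \<and> length A' = length A \<and>
      comp_work (Step Local # draw_trace s @ t) \<le> 31 * m \<and>
      (\<forall>d. m \<le> 2 ^ d \<longrightarrow>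
        comp_span (Step Local # draw_trace s @ t) \<le> 24 * (min_blocks \<epsilon> \<delta> m * b) + 6 + 3 * d) \<and>
      comp_cost (Glob ` {..<Q}) cap b (Step Local # draw_trace s @ t) (line_factor b base * s * g)"
      using spec(1-3) ca work by simp
  qed
qed

section \<open>The recursion\<close>

text \<open>This is a union bound, from \<open>(1 - d) * (1 - a) \<ge> 1 - a - d\<close>; for
  \<open>d > 1\<close> the claim is trivial. Mass lost by \<open>f x\<close> counts as failure, so
  the estimate is carried out in the underlying \<open>pmf\<close> of optional values.\<close>

lemma measure_bind_spmf_of_pmf_ge:
  assumes G: "measure_pmf.prob p G \<ge> 1 - a"
    and f: "\<And>x. x \<in> G \<Longrightarrow> measure (measure_spmf (f x)) B \<ge> 1 - d"
    and "0 \<le> a" "0 \<le> d"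
  shows "measure (measure_spmf (bind_spmf (spmf_of_pmf p) f)) B \<ge> 1 - a - d"
proof (cases "d \<le> 1")
  case True
  have "ennreal ((1 - d) * measure_pmf.prob p G) = (\<integral>\<^sup>+x. ennreal (1 - d) * indicator G x \<partial>measure_pmf p)"
    using True by (simp add: nn_integral_cmult measure_pmf.emeasure_eq_measure ennreal_mult)
  also have "\<dots> \<le> (\<integral>\<^sup>+x. emeasure (measure_pmf (f x)) (Some ` B) \<partial>measure_pmf p)"
  proof (rule nn_integral_mono)
    fix x
    show "ennreal (1 - d) * indicator G x \<le> emeasure (measure_pmf (f x)) (Some ` B)"
      using f[of x] by (cases "x \<in> G")
        (auto simp: measure_measure_spmf_conv_measure_pmf measure_pmf.emeasure_eq_measure intro: ennreal_leI)
  qed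
  also have "\<dots> = ennreal (measure_pmf.prob (bind_pmf p f) (Some ` B))"
    by (simp add: measure_pmf.emeasure_eq_measure[symmetric])
  also have "bind_pmf p f = bind_spmf (spmf_of_pmf p) f" by (rule bind_spmf_of_pmf[symmetric])
  finally have "(1 - d) * measure_pmf.prob p G \<le> measure (measure_spmf (bind_spmf (spmf_of_pmf p) f)) B"
    unfolding measure_measure_spmf_conv_measure_pmf by simp
  moreover have "(1 - d) * (1 - a) \<le> (1 - d) * measure_pmf.prob p G"
    using G True by (intro mult_left_mono) auto
  moreover have "1 - a - d \<le> (1 - d) * (1 - a)"
    using assms(3,4) by (simp add: algebra_simps)
  ultimately show ?thesis by linarith
next
  case False
  then have "1 - a - d \<le> 0" using assms(3) by linarith
  then show ?thesis using measure_nonneg order.trans by blast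
qed

text \<open>A common recursion step for the top level and the deeper ones, which differ in
  \<open>\<delta>\<close> and in the resources they allow. The good set \<open>R m'\<close> of the
  call depends only on the length of its subarray; \<open>comb\<close> joins its computation to the
  computation \<open>T\<close> of the current level.\<close>

lemma smoothed_striding_step:
  fixes A :: "'e list" and \<epsilon> \<delta> \<eta> :: real and b m Q cap base :: nat
  defines "g \<equiv> num_groups b \<epsilon> \<delta> m" and "s \<equiv> num_blocks b \<epsilon> \<delta> m"
  assumes b: "0 < b" and eps: "0 < \<epsilon>" "\<epsilon> \<le> 1 / 2" and del: "0 < \<delta>" "\<delta> < 1"
    and g2: "2 \<le> g" and A: "base + m \<le> length A"
    and Q: "2 * min_blocks \<epsilon> \<delta> m \<le> Q" "3 * Q \<le> cap" and \<eta>: "0 \<le> \<eta>"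
    and rec: "\<And>base' m' A'. base' + m' \<le> length A' \<Longrightarrow> m' \<le> m \<Longrightarrow> real m' \<le> 7 * \<delta> * real m \<Longrightarrow>
      measure (measure_spmf (smoothed_striding P b \<epsilon> \<delta>' \<delta>' base' m' A')) (R m') \<ge> 1 - \<eta>"
    and comb: "\<And>T m' A'' t'. m' \<le> m \<Longrightarrow> real m' \<le> 7 * \<delta> * real m \<Longrightarrow>
      comp_work T \<le> 31 * m \<Longrightarrow>
      \<forall>d. m \<le> 2 ^ d \<longrightarrow> comp_span T \<le> 24 * (min_blocks \<epsilon> \<delta> m * b) + 6 + 3 * d \<Longrightarrow>
      comp_cost (Glob ` {..<Q}) cap b T (line_factor b base * s * g) \<Longrightarrow>
      (A'', t') \<in> R m' \<Longrightarrow> (A'', T @ t') \<in> B"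
  shows "measure (measure_spmf (smoothed_striding P b \<epsilon> \<delta>' \<delta> base m A)) B \<ge> 1 - \<epsilon>\<^sup>2 - \<eta>"
proof -
  from partial_partition_level[OF b eps del g2[unfolded g_def] A Q, folded g_def s_def]
  obtain G where G: "measure_pmf.prob (draw_X g s) G \<ge> 1 - \<epsilon>\<^sup>2"
    and level: "\<And>X a c A' t. X \<in> G \<Longrightarrow> partial_partition P b g s X base m A = ((a, c), A', t) \<Longrightarrow>
      a \<le> c \<and> c \<le> m \<and> real (c - a) \<le> 7 * \<delta> * real m \<and> length A' = length A \<and>
      comp_work (Step Local # draw_trace s @ t) \<le> 31 * m \<and>
      (\<forall>d. m \<le> 2 ^ d \<longrightarrow>
        comp_span (Step Local # draw_trace s @ t) \<le> 24 * (min_blocks \<epsilon> \<delta> m * b) + 6 + 3 * d) \<and>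
      comp_cost (Glob ` {..<Q}) cap b (Step Local # draw_trace s @ t) (line_factor b base * s * g)"
    by blast
  have unfold: "smoothed_striding P b \<epsilon> \<delta>' \<delta> base m A =
    bind_spmf (spmf_of_pmf (draw_X g s)) (\<lambda>X.
       case partial_partition P b g s X base m A of
         ((a, c), A', t) \<Rightarrow>
           map_spmf (\<lambda>(A'', t'). (A'', Step Local # draw_trace s @ t @ t'))
             (smoothed_striding P b \<epsilon> \<delta>' \<delta>' (base + a) (c - a) A'))"
    using g2 unfolding g_def s_def
    by (subst smoothed_striding.simps)
      (simp add: map_spmf_conv_bind_spmf case_prod_beta' cong: if_cong)
  show ?thesis
    unfolding unfold
  proof (rule measure_bind_spmf_of_pmf_ge[OF G])
    fix X assume X: "X \<in> G"
    obtain a c A' t where r: "partial_partition P b g s X base m A = ((a, c), A', t)"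
      by (metis surj_pair)
    note lev = level[OF X r]
    let ?f = "\<lambda>(A'', t'). (A'', Step Local # draw_trace s @ t @ t')"
    have "1 - \<eta> \<le> measure (measure_spmf (smoothed_striding P b \<epsilon> \<delta>' \<delta>' (base + a) (c - a) A')) (R (c - a))"
      using lev A by (intro rec) auto
    also have "\<dots> \<le> measure (measure_spmf (smoothed_striding P b \<epsilon> \<delta>' \<delta>' (base + a) (c - a) A')) (?f -` B)"
    proof (rule measure_spmf.finite_measure_mono)
      show "R (c - a) \<subseteq> ?f -` B"
      proof
        fix x assume x: "x \<in> R (c - a)"
        obtain A'' t' where x_eq: "x = (A'', t')" by (cases x)
        have "(A'', (Step Local # draw_trace s @ t) @ t') \<in> B"
          by (rule comb[of "c - a"]) (use lev x x_eq in auto)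
        then show "x \<in> ?f -` B" by (simp add: x_eq)
      qed
    qed simp
    finally show "1 - \<eta> \<le> measure (measure_spmf (case partial_partition P b g s X base m A of
         ((a, c), A', t) \<Rightarrow>
           map_spmf (\<lambda>(A'', t'). (A'', Step Local # draw_trace s @ t @ t'))
             (smoothed_striding P b \<epsilon> \<delta>' \<delta>' (base + a) (c - a) A'))) B"
      by (simp add: r measure_map_spmf)
  qed (use \<eta> in auto)
qed

text \<open>\<open>k\<close> counts the lines between the start rounded down and the end rounded up
  to line boundaries; at offset 0 this is the length divided by \<open>b\<close>, rounded up. They
  fit next to the pinned lines, so each is loaded at most once.\<close>

lemma serial_level:
  assumes b: "0 < b" and A: "base + m \<le> length A"
    and res: "serial_partition P base compute 0 m A = (v, A', t)"
    and k: "k = (base + m + (b - 1)) div b - base div b" and cap: "Q + k \<le> cap"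
  shows "comp_work (Step Local # t) \<le> 10 * m + 1" "comp_span (Step Local # t) \<le> 10 * m + 1"
    "comp_cost (Glob ` {..<Q}) cap b (Step Local # t) k"
proof -
  have "v = 0 + card {j\<in>{0..<m}. P (A ! (base + id j))} \<and> length A' = length A \<and>
    (\<forall>x. x \<notin> (\<lambda>j. base + id j) ` {0..<m} \<longrightarrow> A' ! x = A ! x) \<and>
    (\<exists>ops. t = map Step ops \<and> length ops \<le> 10 * (m - 0) \<and>
      accessed ops \<subseteq> Glob ` {..<0} \<union> Elem ` (\<lambda>j. base + id j) ` {0..<m})"
    by (rule serial_partition_spec[where tr = "\<lambda>_. [Local]"])
      (use A res in \<open>auto simp: compute_def\<close>)
  then obtain ops where ops: "t = map Step ops" "length ops \<le> 10 * m"
    "accessed (Local # ops) \<subseteq> Glob ` {..<0} \<union> Elem ` {base..<base + m}"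
    by (auto simp: add.commute[of m])
  show "comp_work (Step Local # t) \<le> 10 * m + 1" "comp_span (Step Local # t) \<le> 10 * m + 1"
    using ops by simp_all
  let ?E = "Elem ` {base div b..<(base + m + (b - 1)) div b}"
  have line: "base div b \<le> x div b \<and> x div b < (base + m + (b - 1)) div b"
    if "base \<le> x" "x < base + m" for x
  proof -
    have "(x + b) div b \<le> (base + m + (b - 1)) div b" using that b by (intro div_le_mono) linarith
    then show ?thesis using that b by (auto intro: div_le_mono)
  qed
  have card: "card ?E = k" by (simp add: card_image inj_on_def k)
  have "serve_cost (Glob ` {..<Q}) cap (lines b (Local # ops)) k"
    by (rule serve_cost_strand[OF ops(3), where E = ?E]) (use line card cap in auto)
  then show "comp_cost (Glob ` {..<Q}) cap b (Step Local # t) k"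
    using comp_cost_strand[of _ _ _ "Local # ops"] by (simp add: ops)
qed

lemma serial_lines_le:
  assumes "0 < b"
  shows "real ((base + m + (b - 1)) div b - base div b) \<le> real m / real b + 2"
proof -
  have div: "real (x div b) = of_int \<lfloor>real x / real b\<rfloor>" for x
    by (simp add: floor_divide_of_nat_eq)
  have "real ((base + m + (b - 1)) div b) \<le> real (base + m + (b - 1)) / real b"
    unfolding div by (rule of_int_floor_le)
  moreover have "real base / real b - 1 \<le> real (base div b)"
    unfolding div by linarith
  moreover have "real (base + m + (b - 1)) / real b \<le> real base / real b + real m / real b + 1"
    using assms by (simp add: field_simps)
  moreover have "base div b \<le> (base + m + (b - 1)) div b" by (intro div_le_mono) simp
  ultimately show ?thesis by simp
qed

text \<open>Fewer than two groups means fewer than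
  \<open>2 * b * min_blocks \<epsilon> \<delta> m\<close> elements, hence at most
  \<open>2 * min_blocks \<epsilon> \<delta> m + 2 \<le> 2 * Q\<close> lines. Together with the
  \<open>Q\<close> pinned ones they fit into \<open>3 * Q\<close>, the capacity that also suffices
  for an unaligned stride.\<close>

lemma smoothed_striding_serial:
  fixes A :: "'e list"
  assumes b: "0 < b" and A: "base + m \<le> length A"
    and g: "num_groups b \<epsilon> \<delta> m < 2" and Q: "2 * min_blocks \<epsilon> \<delta> m \<le> Q" "3 * Q \<le> cap"
    and B: "\<And>A' t. comp_work t \<le> 10 * m + 1 \<Longrightarrow> comp_span t \<le> 10 * m + 1 \<Longrightarrow>
      m < 2 * (b * min_blocks \<epsilon> \<delta> m) \<Longrightarrow>
      comp_cost (Glob ` {..<Q}) cap b t ((base + m + (b - 1)) div b - base div b) \<Longrightarrow> (A', t) \<in> B"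
  shows "measure (measure_spmf (smoothed_striding P b \<epsilon> \<delta>' \<delta> base m A)) B = 1"
proof -
  let ?s0 = "min_blocks \<epsilon> \<delta> m"
  have s0: "1 \<le> ?s0" by (simp add: min_blocks_def)
  have m: "m < 2 * (b * ?s0)"
    using g b s0 unfolding num_groups_def by (subst (asm) div_less_iff_less_mult) auto
  obtain v A' t where r: "serial_partition P base compute 0 m A = (v, A', t)" by (metis prod_cases3)
  have "real m / real b \<le> 2 * real ?s0"
  proof -
    have "real m \<le> real (2 * (b * ?s0))" using m by (intro of_nat_mono) simp
    then show ?thesis using b by (simp add: field_simps)
  qed
  then have "real ((base + m + (b - 1)) div b - base div b) \<le> real (2 * Q)"
    using serial_lines_le[OF b, of base m] Q(1) s0 by simp
  then have "Q + ((base + m + (b - 1)) div b - base div b) \<le> cap" using Q(2) by linarith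
  note lev = serial_level[OF b A r refl this]
  have "smoothed_striding P b \<epsilon> \<delta>' \<delta> base m A = return_spmf (A', Step Local # t)"
    using g r by (subst smoothed_striding.simps) simp
  then show ?thesis using B[OF lev(1,2) m lev(3)]
    by (simp add: measure_measure_spmf_conv_measure_pmf indicator_def image_iff)
qed

text \<open>The product counts the lines of the padded subarray, i.e. the misses of a level that
  loads each of them once.\<close>

lemma blocks_times_groups_le:
  assumes "0 < b" "0 < \<epsilon>" "\<epsilon> \<le> 1 / 2" "0 < \<delta>" "1 \<le> num_groups b \<epsilon> \<delta> m"
  shows "real (num_blocks b \<epsilon> \<delta> m * num_groups b \<epsilon> \<delta> m) \<le> (real m + \<delta>\<^sup>2 * real m) / real b"
proof -
  have "1 \<le> m" using assms(5) by (cases m) (auto simp: num_groups_def)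
  note gb = groups_times_line_le[OF assms(1,4,2,3) this]
  have "real (num_groups b \<epsilon> \<delta> m * b * num_blocks b \<epsilon> \<delta> m) \<le> real (m + num_groups b \<epsilon> \<delta> m * b)"
    using step_params(2)[OF assms(1,2,4,5)] by (intro of_nat_mono) simp
  also have "\<dots> \<le> real m + \<delta>\<^sup>2 * real m" using gb by simp
  finally show ?thesis using assms(1) by (simp add: field_simps)
qed

text \<open>The coefficients solve the recursion for halving lengths: 31 + 62/2 = 62 for work and 4
  + 8/2 = 8 for misses, where 4 is a factor 2 for unaligned lines times a factor 2 for padding. The
  additive 1 and 2 come from the final serial call and occur only once.\<close>

definition deep_good :: "nat \<Rightarrow> nat \<Rightarrow> nat \<Rightarrow> nat \<Rightarrow> nat \<Rightarrow> nat \<Rightarrow> ('e list \<times> item list) set" where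
  "deep_good Q cap b lev L m = {(A', t). comp_work t \<le> 62 * m + 1 \<and> comp_span t \<le> (L + 1) * lev \<and>
    (\<exists>k. comp_cost (Glob ` {..<Q}) cap b t k \<and> real k \<le> 8 * real m / real b + 2)}"

text \<open>\<open>L\<close> bounds the number of remaining steps, since
  \<open>7 * \<delta>' \<le> 1 / 2\<close> halves the length and a length of at most 1 is handled
  serially. The common bound \<open>M\<close> on all lengths makes \<open>S\<close>,
  \<open>d\<close> and thus the span \<open>lev\<close> of a level uniform throughout the
  recursion.\<close>

lemma smoothed_striding_deep:
  fixes A :: "'e list"
  assumes b: "0 < b" and eps: "0 < \<epsilon>" "\<epsilon> \<le> 1 / 2" and del: "0 < \<delta>'" "\<delta>' \<le> 1 / 14"
    and S: "\<And>m. m \<le> M \<Longrightarrow> min_blocks \<epsilon> \<delta>' m \<le> S" and Q: "2 * S \<le> Q" "3 * Q \<le> cap"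
    and M: "M \<le> 2 ^ d" and lev: "24 * (S * b) + 6 + 3 * d \<le> lev"
    and "m \<le> 2 ^ L" "m \<le> M" "base + m \<le> length A"
  shows "measure (measure_spmf (smoothed_striding P b \<epsilon> \<delta>' \<delta>' base m A)) (deep_good Q cap b lev L m)
    \<ge> 1 - real L * \<epsilon>\<^sup>2"
proof -
  have serial: "measure (measure_spmf (smoothed_striding P b \<epsilon> \<delta>' \<delta>' base m A)) (deep_good Q cap b lev L m) = 1"
    if "m \<le> M" "base + m \<le> length A" "num_groups b \<epsilon> \<delta>' m < 2" for m base L and A :: "'e list"
  proof (rule smoothed_striding_serial[OF b that(2,3) _ Q(2)])
    show "2 * min_blocks \<epsilon> \<delta>' m \<le> Q" using S[OF that(1)] Q by linarith
    fix A' :: "'e list" and t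
    assume t: "comp_work t \<le> 10 * m + 1" "comp_span t \<le> 10 * m + 1" "m < 2 * (b * min_blocks \<epsilon> \<delta>' m)"
      "comp_cost (Glob ` {..<Q}) cap b t ((base + m + (b - 1)) div b - base div b)"
    have "b * min_blocks \<epsilon> \<delta>' m \<le> S * b"
      using mult_le_mono2[OF S[OF that(1)], of b] by (simp only: mult.commute[of S])
    then have "comp_span t \<le> lev" using t(2,3) lev by linarith
    also have "lev \<le> (L + 1) * lev" by simp
    finally have "comp_span t \<le> (L + 1) * lev" .
    moreover have "real ((base + m + (b - 1)) div b - base div b) \<le> 8 * real m / real b + 2"
    proof -
      have "real m / real b \<le> 8 * real m / real b" by (intro divide_right_mono) auto
      then show ?thesis using serial_lines_le[OF b, of base m] by linarith
    qed
    ultimately show "(A', t) \<in> deep_good Q cap b lev L m"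
      using t unfolding deep_good_def by auto
  qed
  show ?thesis
    using assms(11-)
  proof (induction L arbitrary: m base A)
    case (0 m base A)
    have "m div (b * min_blocks \<epsilon> \<delta>' m) \<le> m" by (rule div_le_dividend)
    then have g: "num_groups b \<epsilon> \<delta>' m < 2"
      using 0(1) unfolding num_groups_def power_0 by linarith
    show ?case using serial[OF 0(2,3) g, of 0] by simp
  next
    case (Suc L m base A)
    show ?case
    proof (cases "num_groups b \<epsilon> \<delta>' m < 2")
      case True
      show ?thesis using serial[OF Suc.prems(2,3) True, of "Suc L"] by simp
    next
      case False
      define g s where "g = num_groups b \<epsilon> \<delta>' m" and "s = num_blocks b \<epsilon> \<delta>' m"
      have g: "2 \<le> g" "1 \<le> g" using False by (auto simp: g_def)
      have half: "2 * m' \<le> m" if "real m' \<le> 7 * \<delta>' * real m" for m'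
      proof -
        have "7 * \<delta>' * real m \<le> (1 / 2) * real m" using del by (intro mult_right_mono) auto
        then show ?thesis using that by linarith
      qed
      have "real (s * g) \<le> (real m + \<delta>'\<^sup>2 * real m) / real b"
        unfolding s_def g_def by (rule blocks_times_groups_le) (use b eps del g in \<open>auto simp: g_def\<close>)
      also have "\<dots> \<le> 2 * real m / real b"
        using del by (intro divide_right_mono) (auto simp: mult_left_le_one_le power_le_one)
      finally have sg: "real (s * g) \<le> 2 * real m / real b" .
      have "line_factor b base * s * g \<le> 2 * (s * g)" by (simp add: line_factor_def)
      then have cost: "real (line_factor b base * s * g) \<le> 4 * real m / real b"
        using sg by linarith
      have S': "2 * min_blocks \<epsilon> \<delta>' m \<le> Q" using S[OF Suc.prems(2)] Q by linarith
      have "measure (measure_spmf (smoothed_striding P b \<epsilon> \<delta>' \<delta>' base m A)) (deep_good Q cap b lev (Suc L) m)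
        \<ge> 1 - \<epsilon>\<^sup>2 - real L * \<epsilon>\<^sup>2"
      proof (rule smoothed_striding_step[OF b eps del(1) _ g(1)[unfolded g_def] Suc.prems(3) S' Q(2)])
        show "1 - real L * \<epsilon>\<^sup>2
            \<le> measure (measure_spmf (smoothed_striding P b \<epsilon> \<delta>' \<delta>' base' m' A')) (deep_good Q cap b lev L m')"
          if "base' + m' \<le> length A'" "m' \<le> m" "real m' \<le> 7 * \<delta>' * real m" for base' m' and A' :: "'e list"
          using that half[OF that(3)] Suc.prems by (intro Suc.IH) auto
      next
        fix T m' and A'' :: "'e list" and t'
        assume T: "m' \<le> m" "real m' \<le> 7 * \<delta>' * real m" "comp_work T \<le> 31 * m"
          "\<forall>d. m \<le> 2 ^ d \<longrightarrow> comp_span T \<le> 24 * (min_blocks \<epsilon> \<delta>' m * b) + 6 + 3 * d"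
          "comp_cost (Glob ` {..<Q}) cap b T
            (line_factor b base * num_blocks b \<epsilon> \<delta>' m * num_groups b \<epsilon> \<delta>' m)"
          and "(A'', t') \<in> deep_good Q cap b lev L m'"
        then obtain k where t': "comp_work t' \<le> 62 * m' + 1" "comp_span t' \<le> (L + 1) * lev"
          "comp_cost (Glob ` {..<Q}) cap b t' k" "real k \<le> 8 * real m' / real b + 2"
          by (auto simp: deep_good_def)
        have m': "2 * m' \<le> m" by (rule half[OF T(2)])
        have "m \<le> 2 ^ d" using M Suc.prems(2) by linarith
        then have "comp_span T \<le> 24 * (min_blocks \<epsilon> \<delta>' m * b) + 6 + 3 * d" using T(4) by blast
        moreover have "min_blocks \<epsilon> \<delta>' m * b \<le> S * b" using S[OF Suc.prems(2)] by (rule mult_le_mono1)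
        ultimately have "comp_span T \<le> lev" using lev by linarith
        then have "comp_span (T @ t') \<le> (Suc L + 1) * lev" using t'(2) by simp
        moreover have "comp_work (T @ t') \<le> 62 * m + 1" using T(3) t'(1) m' by simp
        moreover have "comp_cost (Glob ` {..<Q}) cap b (T @ t') (line_factor b base * s * g + k)"
          using T(5) t'(3) unfolding s_def g_def by (rule comp_cost_append)
        moreover have "real (line_factor b base * s * g + k) \<le> 8 * real m / real b + 2"
        proof -
          have "8 * real m' / real b \<le> 4 * real m / real b"
            using m' by (intro divide_right_mono) auto
          then have "real (line_factor b base * s * g) + real k \<le> 4 * real m / real b + (4 * real m / real b + 2)"
            using cost t'(4) by linarith
          then show ?thesis by simp
        qed
        ultimately show "(A'', T @ t') \<in> deep_good Q cap b lev (Suc L) m"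
          unfolding deep_good_def by blast
      qed (use del in auto)
      then show ?thesis by (simp add: algebra_simps)
    qed
  qed
qed

section \<open>The top level\<close>

text \<open>Here 93 = 31 + 62, and 58 = 1 + 8 * 7 + 1 for the padding of the top level, the deeper
  levels on at most \<open>7 * \<delta> * n\<close> elements, and their additive 2. The disjunction
  sets apart a single serial call on the whole array, where rounding \<open>n / b\<close> up may
  have no \<delta>-term to absorb it.\<close>

definition top_good :: "nat \<Rightarrow> nat \<Rightarrow> nat \<Rightarrow> nat \<Rightarrow> real \<Rightarrow> nat \<Rightarrow> ('e list \<times> item list) set" where
  "top_good Q cap b sp \<delta> n = {(A', t). comp_work t \<le> 93 * n + 1 \<and> comp_span t \<le> sp \<and>
    (\<exists>k. comp_cost (Glob ` {..<Q}) cap b t k \<and>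
      (k \<le> (n + (b - 1)) div b \<or> real k \<le> (real n + 58 * (real n * \<delta>)) / real b))}"

lemma smoothed_striding_top:
  fixes A :: "'e list"
  assumes b: "0 < b" and eps: "0 < \<epsilon>" "\<epsilon> \<le> 1 / 2" and del': "0 < \<delta>'" "\<delta>' \<le> 1 / 14"
    and del: "0 < \<delta>" "\<delta> < 1"
    and S: "\<And>m. m \<le> n \<Longrightarrow> min_blocks \<epsilon> \<delta>' m \<le> S" and S0: "S0 = min_blocks \<epsilon> \<delta> n"
    and Q: "2 * S \<le> Q" "2 * S0 \<le> Q" "3 * Q \<le> cap" and d: "n \<le> 2 ^ d" and A: "length A = n"
  shows "measure (measure_spmf (smoothed_striding P b \<epsilon> \<delta>' \<delta> 0 n A))
    (top_good Q cap b (24 * (S0 * b) + (d + 2) * (24 * (S * b) + 6 + 3 * d)) \<delta> n)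
    \<ge> 1 - real (d + 1) * \<epsilon>\<^sup>2"
proof (cases "num_groups b \<epsilon> \<delta> n < 2")
  case True
  have "measure (measure_spmf (smoothed_striding P b \<epsilon> \<delta>' \<delta> 0 n A))
    (top_good Q cap b (24 * (S0 * b) + (d + 2) * (24 * (S * b) + 6 + 3 * d)) \<delta> n) = 1"
  proof (rule smoothed_striding_serial[OF b _ True Q(2)[unfolded S0] Q(3)])
    fix A' :: "'e list" and t
    assume t: "comp_work t \<le> 10 * n + 1" "comp_span t \<le> 10 * n + 1" "n < 2 * (b * min_blocks \<epsilon> \<delta> n)"
      "comp_cost (Glob ` {..<Q}) cap b t ((0 + n + (b - 1)) div b - 0 div b)"
    have "b * min_blocks \<epsilon> \<delta> n = S0 * b" by (simp add: S0)
    then have "comp_span t \<le> 24 * (S0 * b)" using t(2,3) by linarith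
    then have "comp_span t \<le> 24 * (S0 * b) + (d + 2) * (24 * (S * b) + 6 + 3 * d)" by linarith
    moreover have "comp_work t \<le> 93 * n + 1" using t(1) by linarith
    ultimately show "(A', t) \<in> top_good Q cap b (24 * (S0 * b) + (d + 2) * (24 * (S * b) + 6 + 3 * d)) \<delta> n"
      using t(4) unfolding top_good_def by auto
  qed (use A in auto)
  then show ?thesis by simp
next
  case False
  define g s where "g = num_groups b \<epsilon> \<delta> n" and "s = num_blocks b \<epsilon> \<delta> n"
  have g: "2 \<le> g" "1 \<le> g" using False by (auto simp: g_def)
  have n: "1 \<le> n" using g by (cases n) (auto simp: g_def num_groups_def)
  define lev where "lev = 24 * (S * b) + 6 + 3 * d"
  have del2: "\<delta>\<^sup>2 * real n \<le> \<delta> * real n"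
    using del by (intro mult_right_mono) (auto simp: power2_eq_square mult_left_le)
  have "real (s * g) \<le> (real n + \<delta>\<^sup>2 * real n) / real b"
    unfolding s_def g_def by (rule blocks_times_groups_le) (use b eps del g in \<open>auto simp: g_def\<close>)
  also have "\<dots> \<le> (real n + \<delta> * real n) / real b"
    using del2 by (intro divide_right_mono) auto
  finally have sg: "real (s * g) \<le> (real n + \<delta> * real n) / real b" .
  \<comment> \<open>With at least two groups, two lines have at most
    \<open>\<delta>\<^sup>2 * n\<close> elements, so the additive 2 of \<open>deep_good\<close> is
    covered by \<open>\<delta> * n / b\<close>.\<close>
  have "real (2 * b) \<le> real (g * b)" using g by (intro of_nat_mono mult_le_mono1)
  also have "\<dots> \<le> \<delta>\<^sup>2 * real n"
    unfolding g_def by (rule groups_times_line_le[OF b del(1) eps n])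
  finally have two: "2 \<le> \<delta> * real n / real b" using del2 b by (simp add: field_simps)
  have "measure (measure_spmf (smoothed_striding P b \<epsilon> \<delta>' \<delta> 0 n A))
      (top_good Q cap b (24 * (S0 * b) + (d + 2) * lev) \<delta> n) \<ge> 1 - \<epsilon>\<^sup>2 - real d * \<epsilon>\<^sup>2"
  proof (rule smoothed_striding_step[OF b eps del g(1)[unfolded g_def] _ Q(2)[unfolded S0] Q(3)])
    show "1 - real d * \<epsilon>\<^sup>2
        \<le> measure (measure_spmf (smoothed_striding P b \<epsilon> \<delta>' \<delta>' base' m' A')) (deep_good Q cap b lev d m')"
      if "base' + m' \<le> length A'" "m' \<le> n" for base' m' and A' :: "'e list"
      by (rule smoothed_striding_deep[OF b eps del' S Q(1,3) d]) (use that d lev_def in auto)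
  next
    fix T m' and A'' :: "'e list" and t'
    assume T: "m' \<le> n" "real m' \<le> 7 * \<delta> * real n" "comp_work T \<le> 31 * n"
      "\<forall>d. n \<le> 2 ^ d \<longrightarrow> comp_span T \<le> 24 * (min_blocks \<epsilon> \<delta> n * b) + 6 + 3 * d"
      "comp_cost (Glob ` {..<Q}) cap b T
        (line_factor b 0 * num_blocks b \<epsilon> \<delta> n * num_groups b \<epsilon> \<delta> n)"
      and "(A'', t') \<in> deep_good Q cap b lev d m'"
    then obtain k where t': "comp_work t' \<le> 62 * m' + 1" "comp_span t' \<le> (d + 1) * lev"
      "comp_cost (Glob ` {..<Q}) cap b t' k" "real k \<le> 8 * real m' / real b + 2"
      by (auto simp: deep_good_def)
    have "comp_span T \<le> 24 * (S0 * b) + 6 + 3 * d" using T(4) d by (auto simp: S0)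
    then have "comp_span T \<le> 24 * (S0 * b) + lev" by (simp add: lev_def)
    then have "comp_span (T @ t') \<le> 24 * (S0 * b) + (d + 2) * lev" using t'(2) by simp
    moreover have "comp_work (T @ t') \<le> 93 * n + 1" using T(1,3) t'(1) by simp
    moreover have "comp_cost (Glob ` {..<Q}) cap b (T @ t') (s * g + k)"
      using comp_cost_append[OF T(5) t'(3)] by (simp add: line_factor_def s_def g_def)
    moreover have "real (s * g + k) \<le> (real n + 58 * (real n * \<delta>)) / real b"
    proof -
      have "8 * real m' / real b \<le> 8 * (7 * \<delta> * real n) / real b"
        using T(2) by (intro divide_right_mono) auto
      then have "real (s * g) + real k
          \<le> (real n + \<delta> * real n) / real b + 8 * (7 * \<delta> * real n) / real b + \<delta> * real n / real b"
        using sg t'(4) two by linarith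
      also have "\<dots> = (real n + 58 * (real n * \<delta>)) / real b"
        by (simp add: add_divide_distrib)
      finally show ?thesis by simp
    qed
    ultimately show "(A'', T @ t') \<in> top_good Q cap b (24 * (S0 * b) + (d + 2) * lev) \<delta> n"
      unfolding top_good_def by blast
  qed (use A in auto)
  then show ?thesis by (simp add: lev_def algebra_simps)
qed

section \<open>Estimates in terms of the logarithm of the input size\<close>

lemma min_blocks_le:
  fixes n m :: nat and c \<delta> :: real
  assumes n: "2 \<le> n" and m: "m \<le> n" and c: "0 < c" and del: "0 < \<delta>" "\<delta> \<le> 1"
  shows "real (min_blocks (real n powr (- c)) \<delta> m) \<le> (3 + c) * log 2 n / \<delta>\<^sup>2"
proof -
  define l where "l = log 2 (real n)"
  have l: "1 \<le> l" using n by (simp add: l_def)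
  have ln_n: "ln (real n) \<le> l"
  proof -
    have "ln (real n) = l * ln 2" by (simp add: l_def log_def)
    also have "\<dots> \<le> l * 1" using l ln_2_less_1 by (intro mult_left_mono) auto
    finally show ?thesis by simp
  qed
  have "ln (2 * real m / real n powr (- c)) \<le> (2 + c) * l"
  proof (cases "m = 0")
    case True
    \<comment> \<open>The logarithm is taken at 0 here, where its value is 0.\<close>
    then show ?thesis using c l by simp
  next
    case False
    have "ln (2 * real m / real n powr (- c)) = ln 2 + ln (real m) + c * ln (real n)"
      using False n by (simp add: ln_div ln_mult)
    also have "\<dots> \<le> l + l + c * l"
    proof -
      have "ln (real m) \<le> ln (real n)" using m n False by (subst ln_le_cancel_iff) auto
      then show ?thesis using ln_n ln_2_less_1 l c by (intro add_mono mult_left_mono) auto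
    qed
    finally show ?thesis by (simp add: algebra_simps)
  qed
  then have "ln (2 * real m / real n powr (- c)) / \<delta>\<^sup>2 \<le> (2 + c) * l / \<delta>\<^sup>2"
    by (intro divide_right_mono) auto
  moreover have "real (min_blocks (real n powr (- c)) \<delta> m)
      \<le> max 0 (ln (2 * real m / real n powr (- c)) / \<delta>\<^sup>2) + 1"
    unfolding min_blocks_def by linarith
  moreover have "0 \<le> (2 + c) * l / \<delta>\<^sup>2" using c l by auto
  \<comment> \<open>This absorbs the summand 1 of \<open>min_blocks\<close> and raises
    \<open>2 + c\<close> to \<open>3 + c\<close>.\<close>
  moreover have "1 \<le> l / \<delta>\<^sup>2"
  proof -
    have "\<delta>\<^sup>2 \<le> 1" using del by (simp add: power_le_one)
    then show ?thesis using l del by (simp add: field_simps)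
  qed
  ultimately have "real (min_blocks (real n powr (- c)) \<delta> m) \<le> (2 + c) * l / \<delta>\<^sup>2 + l / \<delta>\<^sup>2"
    by (simp add: max_def split: if_splits)
  also have "\<dots> = (3 + c) * l / \<delta>\<^sup>2" by (simp add: add_divide_distrib[symmetric] algebra_simps)
  finally show ?thesis by (simp add: l_def)
qed

lemma ceiling_lines:
  assumes "0 < b"
  shows "real ((n + (b - 1)) div b) \<le> of_int \<lceil>real n / real b\<rceil>"
proof -
  have "int (n + (b - 1)) div int b \<le> \<lceil>real n / real b\<rceil>"
  proof -
    have "real n \<le> of_int \<lceil>real n / real b\<rceil> * real b"
      using assms le_of_int_ceiling[of "real n / real b"]
      by (simp only: pos_divide_le_eq of_nat_0_less_iff)
    then have "int n \<le> \<lceil>real n / real b\<rceil> * int b"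
      by (metis of_int_le_iff of_int_mult of_int_of_nat_eq)
    then have "int (n + (b - 1)) < (\<lceil>real n / real b\<rceil> + 1) * int b"
      using assms by (simp add: algebra_simps)
    also have "int (n + (b - 1)) = int (n + (b - 1)) div int b * int b + int (n + (b - 1)) mod int b"
      by (rule div_mult_mod_eq[symmetric])
    finally have "int (n + (b - 1)) div int b * int b < (\<lceil>real n / real b\<rceil> + 1) * int b"
      using assms pos_mod_sign[of "int b" "int (n + (b - 1))"] by linarith
    then have "int (n + (b - 1)) div int b < \<lceil>real n / real b\<rceil> + 1"
      by (rule mult_right_less_imp_less) simp
    then show ?thesis by simp
  qed
  then have "of_int (int ((n + (b - 1)) div b)) \<le> (of_int \<lceil>real n / real b\<rceil> :: real)"
    unfolding of_int_le_iff zdiv_int .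
  then show ?thesis by simp
qed

text \<open>These are the demands on large \<open>n\<close>: a small \<open>\<epsilon>\<close>, room
  for the union bound over the levels, and a logarithm that exceeds the constant factor
  \<open>K\<close> in the required cache size.\<close>

lemma asymp_conditions:
  assumes "0 < (c::real)"
  obtains N where "\<And>n::nat. n \<ge> N \<Longrightarrow> 2 \<le> n \<and> real n powr (- c) \<le> 1 / 2 \<and>
    log 2 n + 2 \<le> real n powr c \<and> K \<le> log 2 n"
proof -
  have "eventually (\<lambda>n::nat. 2 \<le> n) at_top" by (rule eventually_ge_at_top)
  moreover have "eventually (\<lambda>n::nat. real n powr (- c) \<le> 1 / 2) at_top"
    using assms by real_asymp
  moreover have "eventually (\<lambda>n::nat. log 2 n + 2 \<le> real n powr c) at_top"
    using assms by real_asymp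
  moreover have "eventually (\<lambda>n::nat. K \<le> log 2 n) at_top"
    by real_asymp
  ultimately have "eventually (\<lambda>n::nat. 2 \<le> n \<and> real n powr (- c) \<le> 1 / 2 \<and>
    log 2 n + 2 \<le> real n powr c \<and> K \<le> log 2 n) at_top"
    by eventually_elim simp
  then show ?thesis using that unfolding eventually_at_top_linorder by blast
qed

text \<open>The two forms of the miss bound differ in the rounding of \<open>n / b\<close> to whole
  lines. It vanishes if \<open>b\<close> divides \<open>n\<close> and is part of the \<delta>-term
  if \<open>b \<le> \<delta> * n\<close>. Otherwise the array may be partitioned by one serial call
  that also loads an incomplete last line, whence the ceiling.\<close>

theorem theorem11:
  fixes c :: real
  assumes "c > 0"
  shows "\<exists>\<delta>\<^sub>0 > 0. \<forall>\<delta>'. 0 < \<delta>' \<and> \<delta>' \<le> \<delta>\<^sub>0 \<longrightarrow> (\<forall>k::nat. \<exists>(C::real) (c\<^sub>0::real) (N::nat).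
    \<forall>c' \<ge> c\<^sub>0. \<forall>n \<ge> N. \<forall>(b::nat) (\<delta>::real) (P :: 'e \<Rightarrow> bool) (A :: 'e list).
      1 \<le> b \<and> b < n \<and> 0 < \<delta> \<and> \<delta> < 1 / 2 \<and> \<delta> \<ge> 1 / log 2 n ^ k \<and> length A = n \<longrightarrow>
      measure (measure_spmf (recursive_smoothed_striding P b c \<delta>' \<delta> A))
        {(A', t).
           comp_work t \<le> C * n \<and>
           comp_span t \<le> C * (b * ((log 2 n)\<^sup>2 + log 2 n / \<delta>\<^sup>2)) \<and>
           (\<forall>\<sigma>. schedule t \<sigma> \<longrightarrow>
             (let misses = real (cache_misses b (nat \<lfloor>log 2 n powr c'\<rfloor>) \<sigma>) in
               misses \<le> \<lceil>n / b\<rceil> + C * (n * \<delta>) / b \<and>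
               (b dvd n \<or> b \<le> \<delta> * n \<longrightarrow> misses \<le> (n + C * (n * \<delta>)) / b)))}
        \<ge> 1 - n powr (- c))"
proof (rule exI[of _ "1 / 14 :: real"], intro conjI allI impI)
  show "0 < (1 / 14 :: real)" by simp
  fix \<delta>' :: real and k :: nat
  assume "0 < \<delta>' \<and> \<delta>' \<le> 1 / 14"
  then have del': "0 < \<delta>'" "\<delta>' \<le> 1 / 14" by auto
  note c = \<open>0 < c\<close>
  \<comment> \<open>\<open>C1\<close> bounds the span of a deeper level in units of
    \<open>b * log 2 n\<close>, and \<open>4 * C1\<close> accounts for the at most
    \<open>4 * log 2 n\<close> levels. In \<open>C\<close>, 94 covers the work and
    \<open>24 * (3 + c)\<close> the span of the top level.\<close>
  define C1 where "C1 = 24 * (3 + c) / \<delta>'\<^sup>2 + 12"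
  define C where "C = 94 + 24 * (3 + c) + 4 * C1"
  define K where "K = 6 * (3 + c) * (1 / \<delta>'\<^sup>2 + 1)"
  have C1: "0 \<le> C1" using c by (simp add: C1_def)
  obtain N where N: "\<And>n::nat. n \<ge> N \<Longrightarrow> 2 \<le> n \<and> real n powr (- c) \<le> 1 / 2 \<and>
    log 2 n + 2 \<le> real n powr c \<and> K \<le> log 2 n"
    using asymp_conditions[OF c] by blast
  show "\<exists>(C::real) (c\<^sub>0::real) (N::nat).
    \<forall>c' \<ge> c\<^sub>0. \<forall>n \<ge> N. \<forall>(b::nat) (\<delta>::real) (P :: 'e \<Rightarrow> bool) (A :: 'e list).
      1 \<le> b \<and> b < n \<and> 0 < \<delta> \<and> \<delta> < 1 / 2 \<and> \<delta> \<ge> 1 / log 2 n ^ k \<and> length A = n \<longrightarrow>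
      measure (measure_spmf (recursive_smoothed_striding P b c \<delta>' \<delta> A))
        {(A', t).
           comp_work t \<le> C * n \<and>
           comp_span t \<le> C * (b * ((log 2 n)\<^sup>2 + log 2 n / \<delta>\<^sup>2)) \<and>
           (\<forall>\<sigma>. schedule t \<sigma> \<longrightarrow>
             (let misses = real (cache_misses b (nat \<lfloor>log 2 n powr c'\<rfloor>) \<sigma>) in
               misses \<le> \<lceil>n / b\<rceil> + C * (n * \<delta>) / b \<and>
               (b dvd n \<or> b \<le> \<delta> * n \<longrightarrow> misses \<le> (n + C * (n * \<delta>)) / b)))}
        \<ge> 1 - n powr (- c)"
  \<comment> \<open>\<open>Q\<close> is of order \<open>log 2 n / \<delta>\<^sup>2\<close>, so at
    most a constant times the power \<open>2 * k + 1\<close> of the logarithm; one more factor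
    \<open>log 2 n \<ge> K\<close> absorbs the constant.\<close>
  proof (rule exI[of _ C], rule exI[of _ "real (2 * k + 2)"], rule exI[of _ N],
      intro allI impI, elim conjE)
    fix c' :: real and n b :: nat and \<delta> :: real and P :: "'e \<Rightarrow> bool" and A :: "'e list"
    assume c': "real (2 * k + 2) \<le> c'" and "N \<le> n" and b: "1 \<le> b" and "b < n"
      and del: "0 < \<delta>" "\<delta> < 1 / 2" "1 / log 2 n ^ k \<le> \<delta>" and A: "length A = n"
    define l where "l = log 2 (real n)"
    define \<epsilon> where "\<epsilon> = real n powr (- c)"
    have n: "2 \<le> n" and eps: "0 < \<epsilon>" "\<epsilon> \<le> 1 / 2" and lc: "l + 2 \<le> real n powr c" and lK: "K \<le> l"
      using N[OF \<open>N \<le> n\<close>] by (auto simp: l_def \<epsilon>_def)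
    have l: "1 \<le> l" using n by (simp add: l_def)
    define d where "d = nat \<lceil>l\<rceil>"
    have d: "l \<le> real d" "real d \<le> l + 1" using l by (auto simp: d_def)
    have nd: "n \<le> 2 ^ d"
    proof -
      have "real n = 2 powr l" using n by (simp add: l_def)
      also have "\<dots> \<le> 2 powr real d" using d by (intro powr_mono) auto
      finally have "real n \<le> real (2 ^ d)" by (simp add: powr_realpow)
      then show ?thesis by (simp only: of_nat_le_iff)
    qed
    define S where "S = nat \<lfloor>(3 + c) * l / \<delta>'\<^sup>2\<rfloor>"
    define S0 where "S0 = min_blocks \<epsilon> \<delta> n"
    \<comment> \<open>The pinned set must be the same on all levels, so it covers \<open>X\<close>
      for both parameters.\<close>
    define Q where "Q = 2 * (S + S0)"
    define cap where "cap = nat \<lfloor>l powr c'\<rfloor>"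
    have S: "min_blocks \<epsilon> \<delta>' m \<le> S" if "m \<le> n" for m
      using min_blocks_le[OF n that c, of \<delta>'] del' by (simp add: S_def \<epsilon>_def l_def le_nat_floor)
    have S_le: "real S \<le> (3 + c) * l / \<delta>'\<^sup>2"
      using c l by (simp add: S_def of_nat_floor)
    have S0_le: "real S0 \<le> (3 + c) * l / \<delta>\<^sup>2"
      using min_blocks_le[OF n order.refl c, of \<delta>] del by (simp add: S0_def \<epsilon>_def l_def)
    have inv_del: "1 / \<delta>\<^sup>2 \<le> l ^ (2 * k)"
    proof -
      have "1 / \<delta> \<le> l ^ k" using del l by (simp add: l_def field_simps)
      then have "(1 / \<delta>)\<^sup>2 \<le> (l ^ k)\<^sup>2" using del by (intro power_mono) auto
      then show ?thesis by (simp add: power_divide power_mult[symmetric] mult.commute)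
    qed
    have cap: "3 * Q \<le> cap"
    proof -
      have "real (3 * Q) = 6 * real S + 6 * real S0" by (simp add: Q_def)
      also have "\<dots> \<le> 6 * ((3 + c) * l / \<delta>'\<^sup>2) + 6 * ((3 + c) * l * l ^ (2 * k))"
      proof -
        have "(3 + c) * l / \<delta>\<^sup>2 \<le> (3 + c) * l * l ^ (2 * k)"
          using mult_left_mono[OF inv_del, of "(3 + c) * l"] c l by simp
        then show ?thesis using S_le S0_le by linarith
      qed
      also have "6 * ((3 + c) * l / \<delta>'\<^sup>2) \<le> 6 * ((3 + c) * l / \<delta>'\<^sup>2) * l ^ (2 * k)"
      proof -
        have "0 \<le> 6 * ((3 + c) * l / \<delta>'\<^sup>2)" using c l by simp
        from mult_left_mono[OF one_le_power[OF l] this, of "2 * k"] show ?thesis by simp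
      qed
      also have "6 * ((3 + c) * l / \<delta>'\<^sup>2) * l ^ (2 * k) + 6 * ((3 + c) * l * l ^ (2 * k))
          = K * (l * l ^ (2 * k))"
        by (simp add: K_def algebra_simps add_divide_distrib)
      also have "\<dots> \<le> l * (l * l ^ (2 * k))"
        using lK l by (intro mult_right_mono) auto
      also have "\<dots> = l powr real (2 * k + 2)"
        using l by (subst powr_realpow) auto
      also have "\<dots> \<le> l powr c'" using l c' by (intro powr_mono) auto
      finally show ?thesis by (simp add: cap_def le_nat_floor)
    qed
    define sp where "sp = 24 * (S0 * b) + (d + 2) * (24 * (S * b) + 6 + 3 * d)"
    have sp: "real sp \<le> C * (real b * (l\<^sup>2 + l / \<delta>\<^sup>2))"
    proof -
      have b1: "1 \<le> real b" using b by simp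
      have lb: "1 \<le> l * real b" using mult_mono[OF l b1] l by simp
      have "l * 1 \<le> l * real b" using l b1 by (intro mult_left_mono) auto
      then have d_le: "real d \<le> 2 * (l * real b)" using d(2) l by linarith
      have "real S * real b \<le> (3 + c) * l / \<delta>'\<^sup>2 * real b"
        using S_le by (intro mult_right_mono) auto
      then have "24 * (real S * real b) + 6 + 3 * real d \<le> 24 * ((3 + c) * l / \<delta>'\<^sup>2 * real b) + 12 * (l * real b)"
        using lb d_le by linarith
      also have "\<dots> = C1 * (l * real b)" by (simp add: C1_def algebra_simps add_divide_distrib)
      finally have lev: "24 * (real S * real b) + 6 + 3 * real d \<le> C1 * (l * real b)" .
      have "real d + 2 \<le> 4 * l" using d(2) l by linarith
      then have "(real d + 2) * (24 * (real S * real b) + 6 + 3 * real d) \<le> (4 * l) * (C1 * (l * real b))"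
        using lev l by (intro mult_mono) auto
      then have 1: "(real d + 2) * (24 * (real S * real b) + 6 + 3 * real d) \<le> 4 * C1 * (real b * l\<^sup>2)"
        by (simp add: power2_eq_square mult_ac)
      have "real S0 * real b \<le> (3 + c) * l / \<delta>\<^sup>2 * real b"
        using S0_le by (intro mult_right_mono) auto
      also have "\<dots> = (3 + c) * (real b * (l / \<delta>\<^sup>2))" by simp
      finally have 2: "24 * (real S0 * real b) \<le> 24 * (3 + c) * (real b * (l / \<delta>\<^sup>2))"
        by linarith
      have 3: "4 * C1 * (real b * l\<^sup>2) \<le> C * (real b * l\<^sup>2)"
        using c C1 by (intro mult_right_mono) (auto simp: C_def)
      have 4: "24 * (3 + c) * (real b * (l / \<delta>\<^sup>2)) \<le> C * (real b * (l / \<delta>\<^sup>2))"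
        using c C1 l by (intro mult_right_mono) (auto simp: C_def)
      have "real sp = 24 * (real S0 * real b) + (real d + 2) * (24 * (real S * real b) + 6 + 3 * real d)"
        by (simp add: sp_def algebra_simps)
      then have "real sp \<le> C * (real b * l\<^sup>2) + C * (real b * (l / \<delta>\<^sup>2))"
        using 1 2 3 4 by linarith
      then show ?thesis by (simp add: distrib_left)
    qed
    have C58: "58 \<le> C" "94 \<le> C" using c C1 by (auto simp: C_def)
    let ?good = "{(A' :: 'e list, t). comp_work t \<le> C * n \<and>
           comp_span t \<le> C * (b * ((log 2 n)\<^sup>2 + log 2 n / \<delta>\<^sup>2)) \<and>
           (\<forall>\<sigma>. schedule t \<sigma> \<longrightarrow>
             (let misses = real (cache_misses b (nat \<lfloor>log 2 n powr c'\<rfloor>) \<sigma>) in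
               misses \<le> \<lceil>n / b\<rceil> + C * (n * \<delta>) / b \<and>
               (b dvd n \<or> b \<le> \<delta> * n \<longrightarrow> misses \<le> (n + C * (n * \<delta>)) / b)))}"
    have misses: "real j \<le> \<lceil>n / b\<rceil> + C * (n * \<delta>) / b \<and>
        (b dvd n \<or> b \<le> \<delta> * n \<longrightarrow> real j \<le> (n + C * (n * \<delta>)) / b)"
      if "j \<le> (n + (b - 1)) div b \<or> real j \<le> (real n + 58 * (real n * \<delta>)) / real b" for j
      using that
    proof
      assume j: "j \<le> (n + (b - 1)) div b"
      have "real j \<le> real ((n + (b - 1)) div b)" using j by simp
      also have "\<dots> \<le> \<lceil>n / b\<rceil>" using b by (intro ceiling_lines) auto
      finally have j': "real j \<le> \<lceil>n / b\<rceil>" .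
      have nn: "0 \<le> C * (n * \<delta>) / b" using C58 del by simp
      have "real j \<le> (n + C * (n * \<delta>)) / b" if "b dvd n"
      proof -
        have "real n / real b = of_int (int (n div b))" using that by (simp add: real_of_nat_div)
        then have "of_int \<lceil>n / b\<rceil> = real n / real b" by (metis ceiling_of_int)
        then show ?thesis using j' nn unfolding add_divide_distrib by linarith
      qed
      moreover have "real j \<le> (n + C * (n * \<delta>)) / b" if "b \<le> \<delta> * n"
      proof -
        have "1 * (n * \<delta>) \<le> C * (n * \<delta>)" using C58 del by (intro mult_right_mono) auto
        then have "real b \<le> C * (n * \<delta>)" using that by (simp add: mult.commute)
        then have "1 \<le> C * (n * \<delta>) / b" using b by (simp add: field_simps)
        moreover have "of_int \<lceil>n / b\<rceil> \<le> real n / real b + 1" by linarith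
        ultimately show ?thesis using j' unfolding add_divide_distrib by linarith
      qed
      ultimately show ?thesis using j' nn by auto
    next
      assume "real j \<le> (real n + 58 * (real n * \<delta>)) / real b"
      also have "\<dots> \<le> (n + C * (n * \<delta>)) / b"
        using C58 del by (intro divide_right_mono add_left_mono mult_right_mono) auto
      finally have j: "real j \<le> (n + C * (n * \<delta>)) / b" .
      moreover have "real n / real b \<le> \<lceil>n / b\<rceil>" by (rule le_of_int_ceiling)
      ultimately show ?thesis unfolding add_divide_distrib by linarith
    qed
    have subset: "top_good Q cap b sp \<delta> n \<subseteq> ?good"
    proof (clarify, intro conjI allI impI)
      fix A' :: "'e list" and t
      assume "(A', t) \<in> top_good Q cap b sp \<delta> n"
      then obtain j where t: "comp_work t \<le> 93 * n + 1" "comp_span t \<le> sp"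
        "comp_cost (Glob ` {..<Q}) cap b t j"
        "j \<le> (n + (b - 1)) div b \<or> real j \<le> (real n + 58 * (real n * \<delta>)) / real b"
        by (auto simp: top_good_def)
      have "real (comp_work t) \<le> real (94 * n)" using t(1) n by (intro of_nat_mono) linarith
      also have "\<dots> \<le> C * n" using mult_right_mono[OF C58(2), of "real n"] by simp
      finally show "comp_work t \<le> C * n" .
      have "real (comp_span t) \<le> real sp" using t(2) by simp
      then show "comp_span t \<le> C * (b * ((log 2 n)\<^sup>2 + log 2 n / \<delta>\<^sup>2))"
        using sp by (simp add: l_def)
      fix \<sigma> assume \<sigma>: "schedule t \<sigma>"
      have "card (Glob ` {..<Q}) \<le> Q" using card_image_le[of "{..<Q}" Glob] by simp
      then have "cache_misses b cap \<sigma> \<le> j"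
        using cap by (intro cache_misses_le[OF \<sigma> t(3)]) auto
      then have le: "real (cache_misses b (nat \<lfloor>log 2 n powr c'\<rfloor>) \<sigma>) \<le> real j"
        by (simp add: cap_def l_def)
      show "let misses = real (cache_misses b (nat \<lfloor>log 2 n powr c'\<rfloor>) \<sigma>) in
               misses \<le> \<lceil>n / b\<rceil> + C * (n * \<delta>) / b \<and>
               (b dvd n \<or> b \<le> \<delta> * n \<longrightarrow> misses \<le> (n + C * (n * \<delta>)) / b)"
        unfolding Let_def using misses[OF t(4)] le by auto
    qed
    have "1 - real n powr (- c) \<le> 1 - real (d + 1) * \<epsilon>\<^sup>2"
    proof -
      \<comment> \<open>One of the two factors \<open>\<epsilon>\<close> in the failure probability
        of a level pays for the number of levels.\<close>
      have "real (d + 1) * \<epsilon> \<le> real n powr c * \<epsilon>"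
        using d(2) lc eps by (intro mult_right_mono) auto
      also have "\<dots> = 1" using n by (simp add: \<epsilon>_def powr_minus)
      finally have "real (d + 1) * \<epsilon> * \<epsilon> \<le> 1 * \<epsilon>" using eps by (intro mult_right_mono) auto
      then show ?thesis by (simp add: \<epsilon>_def[symmetric] power2_eq_square)
    qed
    also have "\<dots> \<le> measure (measure_spmf (smoothed_striding P b \<epsilon> \<delta>' \<delta> 0 n A)) (top_good Q cap b sp \<delta> n)"
      unfolding sp_def
      by (rule smoothed_striding_top) (use b eps del' del S S0_def cap nd A in \<open>auto simp: Q_def\<close>)
    also have "\<dots> \<le> measure (measure_spmf (smoothed_striding P b \<epsilon> \<delta>' \<delta> 0 n A)) ?good"
      by (rule measure_spmf.finite_measure_mono[OF subset]) simp
    also have "smoothed_striding P b \<epsilon> \<delta>' \<delta> 0 n A = recursive_smoothed_striding P b c \<delta>' \<delta> A"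
      by (simp add: recursive_smoothed_striding_def \<epsilon>_def A)
    finally show "1 - n powr (- c) \<le> measure (measure_spmf (recursive_smoothed_striding P b c \<delta>' \<delta> A)) ?good" .
  qed
qed

end
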